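(* Let $\alpha\vDash n$ and let $E$ be an equivalence class of $\mathrm{SRCT}(\alpha)$ under the equivalence relation $\sim_\alpha$. Let $\tau_{0,E}$ and $\tau_{1,E}$ be the unique source tableau and the unique sink tableau in $E$. Then the poset $(E,\preccurlyeq_\alpha)$ has the structure of a graded lattice and is isomorphic to the subinterval $[\mathrm{col}_{\tau_{0,E}},\mathrm{col}_{\tau_{1,E}}]$ of $\mathfrak{S}_n$ under the (left) weak Bruhat order $\leq_L$.
   Context: A composition $\alpha=(\alpha_1,\ldots,\alpha_k)$ of $n$ ($\alpha\vDash n$) is an ordered list of positive integers summing to $n$. Its reverse composition diagram is the array of left-justified cells with $\alpha_i$ cells in row $i$ from the top; $(i,j)$ is the cell in row $i$, column $j$. A standard reverse composition tableau (SRCT) of shape $\alpha\vDash n$ is a bijective filling $\tau:\alpha\to\{1,\ldots,n\}$ such that (1) rows decrease from left to right; (2) the first column increases from top to bottom; (3) (triple rule) if $i<j$ and $\tau(i,k)>\tau(j,k+1)$, then $\tau(i,k+1)$ exists and $\tau(i,k+1)>\tau(j,k+1)$. $\mathrm{SRCT}(\alpha)$ is the set of SRCTs of shape $\alpha$. $\mathrm{Des}(\tau)=\{i\in[n-1]: i+1\text{ appears weakly right of } i\}$. Entries $i,i+1$ are attacking in $\tau$ if they are in the same column, or in adjacent columns with $i+1$ strictly southeast of $i$. For $1\leq i\leq n-1$, $\pi_i(\tau)=\tau$ if $i\notin\mathrm{Des}(\tau)$; $\pi_i(\tau)=0$ if $i\in\mathrm{Des}(\tau)$ and $i,i+1$ are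 attacking; and $\pi_i(\tau)=s_i(\tau)$, the SRCT obtained by interchanging the positions of $i$ and $i+1$, if $i\in\mathrm{Des}(\tau)$ and $i,i+1$ are non-attacking; extend linearly. The $\pi_i$ satisfy the $0$-Hecke relations, so $\pi_\sigma:=\pi_{i_1}\cdots\pi_{i_p}$ is well defined for $\sigma\in\mathfrak{S}_n$ with reduced word $s_{i_1}\cdots s_{i_p}$. The partial order on $\mathrm{SRCT}(\alpha)$ is: $\tau\preccurlyeq_\alpha\tau'$ iff $\pi_\sigma(\tau)=\tau'$ for some $\sigma\in\mathfrak{S}_n$. The column word $\mathrm{col}_\tau$ is $w^1w^2\cdots w^{\alpha_{max}}$ where $w^i$ is the word of entries of column $i$ read from top to bottom and $\alpha_{max}$ is the largest part of $\alpha$; it is identified with a permutation in $\mathfrak{S}_n$ in one-line notation. The standardization of a word $w_1\cdots w_r$ of distinct positive integers is the permutation $\sigma\in\mathfrak{S}_r$ with $\sigma(i)<\sigma(j)$ iff $w_i<w_j$. The standardized column word $\mathrm{st}(\tau)$ is the concatenation of the standardizations of $w^1,\ldots,w^{\alpha_{max}}$, and $\tau\sim_\alpha\tau'$ iff $\mathrm{st}(\tau)=\mathrm{st}(\tau')$ (equivalently, in each column the entries of $\tau$ and $\tau'$ are in the same relative order). An SRCT $\tau$ is a source tableau if for every $i\notin\mathrm{Des}(\tau)$ with $i\neq n$, $i+1$ lies to the immediate left of $i$; it is a sink tableau if for every $i\in\mathrm{Des}(\tau)$, $i$ and $i+1$ are attacking. Each equivalence class contains exactly one source tableau and exactly one sink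 tableau. The weak Bruhat order: $\sigma_1\leq_L\sigma_2$ iff there are adjacent transpositions with $\sigma_2=s_{i_k}\cdots s_{i_1}\sigma_1$ and $l(s_{i_r}\cdots s_{i_1}\sigma_1)=l(\sigma_1)+r$ for $1\leq r\leq k$, where $l$ is Coxeter length; equivalently $\mathrm{Inv}(\sigma_1)\subseteq\mathrm{Inv}(\sigma_2)$, where $\mathrm{Inv}(\sigma)=\{(p,q): p<q,\ \sigma(p)>\sigma(q)\}$. *)

theory Defs
  imports
    "HOL-Library.Poly_Mapping"
    "HOL-Combinatorics.Permutations"
    "HOL-Algebra.Lattice"
begin

definition composition_of :: "nat list \<Rightarrow> nat \<Rightarrow> bool" (infix \<open>\<Turnstile>c\<close> 50) where
  "\<alpha> \<Turnstile>c n \<longleftrightarrow> (\<forall>a \<in> set \<alpha>. a > 0) \<and> sum_list \<alpha> = n"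

text \<open>A cell is a pair (row, column), both counted from 1; rows are numbered from the top.\<close>

type_synonym cell = "nat \<times> nat"
type_synonym filling = "cell \<Rightarrow> nat"

definition diagram :: "nat list \<Rightarrow> cell set" where
  "diagram \<alpha> = {(i, j). 1 \<le> i \<and> i \<le> length \<alpha> \<and> 1 \<le> j \<and> j \<le> \<alpha> ! (i - 1)}"

text \<open>
  Fillings are total functions; the value 0 off the diagram makes two tableaux equal exactly
  when they agree on the diagram, and it is not affected by exchanging two entries.
\<close>

definition SRCT :: "nat list \<Rightarrow> filling set" where
  "SRCT \<alpha> = {\<tau>.
     bij_betw \<tau> (diagram \<alpha>) {1..sum_list \<alpha>} \<and>
     (\<forall>c. c \<notin> diagram \<alpha> \<longrightarrow> \<tau> c = 0) \<and>
     (\<forall>i j k. j < k \<and> (i, j) \<in> diagram \<alpha> \<and> (i, k) \<in> diagram \<alpha> \<longrightarrow> \<tau> (i, j) > \<tau> (i, k)) \<and>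
     (\<forall>i j. i < j \<and> (i, 1) \<in> diagram \<alpha> \<and> (j, 1) \<in> diagram \<alpha> \<longrightarrow> \<tau> (i, 1) < \<tau> (j, 1)) \<and>
     (\<forall>i j k. i < j \<and> (i, k) \<in> diagram \<alpha> \<and> (j, k + 1) \<in> diagram \<alpha> \<and> \<tau> (i, k) > \<tau> (j, k + 1)
        \<longrightarrow> (i, k + 1) \<in> diagram \<alpha> \<and> \<tau> (i, k + 1) > \<tau> (j, k + 1))}"

definition cell_of :: "nat list \<Rightarrow> filling \<Rightarrow> nat \<Rightarrow> cell" where
  "cell_of \<alpha> \<tau> m = inv_into (diagram \<alpha>) \<tau> m"

definition row_of :: "nat list \<Rightarrow> filling \<Rightarrow> nat \<Rightarrow> nat" where
  "row_of \<alpha> \<tau> m = fst (cell_of \<alpha> \<tau> m)"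

definition col_of :: "nat list \<Rightarrow> filling \<Rightarrow> nat \<Rightarrow> nat" where
  "col_of \<alpha> \<tau> m = snd (cell_of \<alpha> \<tau> m)"

definition Des :: "nat list \<Rightarrow> filling \<Rightarrow> nat set" where
  "Des \<alpha> \<tau> = {i \<in> {1..<sum_list \<alpha>}. col_of \<alpha> \<tau> (i + 1) \<ge> col_of \<alpha> \<tau> i}"

definition attacking :: "nat list \<Rightarrow> filling \<Rightarrow> nat \<Rightarrow> bool" where
  "attacking \<alpha> \<tau> i \<longleftrightarrow>
     col_of \<alpha> \<tau> (i + 1) = col_of \<alpha> \<tau> i \<or>
     (col_of \<alpha> \<tau> (i + 1) = col_of \<alpha> \<tau> i + 1 \<and> row_of \<alpha> \<tau> (i + 1) > row_of \<alpha> \<tau> i)"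

definition source_tableau :: "nat list \<Rightarrow> filling \<Rightarrow> bool" where
  "source_tableau \<alpha> \<tau> \<longleftrightarrow>
     (\<forall>i \<in> {1..sum_list \<alpha>}. i \<notin> Des \<alpha> \<tau> \<and> i \<noteq> sum_list \<alpha> \<longrightarrow>
        row_of \<alpha> \<tau> (i + 1) = row_of \<alpha> \<tau> i \<and> col_of \<alpha> \<tau> (i + 1) + 1 = col_of \<alpha> \<tau> i)"

definition sink_tableau :: "nat list \<Rightarrow> filling \<Rightarrow> bool" where
  "sink_tableau \<alpha> \<tau> \<longleftrightarrow> (\<forall>i \<in> Des \<alpha> \<tau>. attacking \<alpha> \<tau> i)"

text \<open>
  Permutations of [n] are functions that permute \<open>{1..n}\<close> (and fix everything else), multiplied
  by composition.  A word \<open>[i\<^sub>1, \<dots>, i\<^sub>p]\<close> stands for the product of the adjacent transpositions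
  \<open>s\<^sub>i\<close> in this order, so the rightmost one acts first.
\<close>

definition adj_transp :: "nat \<Rightarrow> nat \<Rightarrow> nat" where
  "adj_transp i = Transposition.transpose i (i + 1)"

definition word_perm :: "nat list \<Rightarrow> nat \<Rightarrow> nat" where
  "word_perm w = foldr (\<lambda>i \<sigma>. adj_transp i \<circ> \<sigma>) w id"

definition cox_length :: "nat \<Rightarrow> (nat \<Rightarrow> nat) \<Rightarrow> nat" where
  "cox_length n \<sigma> = (LEAST k. \<exists>w. set w \<subseteq> {1..<n} \<and> word_perm w = \<sigma> \<and> length w = k)"

definition reduced_word :: "nat \<Rightarrow> (nat \<Rightarrow> nat) \<Rightarrow> nat list \<Rightarrow> bool" where
  "reduced_word n \<sigma> w \<longleftrightarrow>
     set w \<subseteq> {1..<n} \<and> word_perm w = \<sigma> \<and> length w = cox_length n \<sigma>"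

definition weak_bruhat_le :: "nat \<Rightarrow> (nat \<Rightarrow> nat) \<Rightarrow> (nat \<Rightarrow> nat) \<Rightarrow> bool" where
  "weak_bruhat_le n \<sigma>\<^sub>1 \<sigma>\<^sub>2 \<longleftrightarrow>
     (\<exists>is. set is \<subseteq> {1..<n} \<and>
        \<sigma>\<^sub>2 = word_perm (rev is) \<circ> \<sigma>\<^sub>1 \<and>
        (\<forall>r \<in> {1..length is}.
           cox_length n (word_perm (rev (take r is)) \<circ> \<sigma>\<^sub>1) = cox_length n \<sigma>\<^sub>1 + r))"

definition weak_bruhat :: "nat \<Rightarrow> (nat \<Rightarrow> nat) gorder" where
  "weak_bruhat n = \<lparr>carrier = {\<sigma>. \<sigma> permutes {1..n}}, eq = (=), le = weak_bruhat_le n\<rparr>"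

text \<open>
  The operators act on the free module with basis the fillings; \<^const>\<open>frag_extend\<close> is linear
  extension from the basis elements \<open>frag_of \<tau>\<close>.  Only the images of basis elements enter the
  order below, so the choice of the integers as coefficients is immaterial.
\<close>

definition swap_entries :: "nat \<Rightarrow> filling \<Rightarrow> filling" where
  "swap_entries i \<tau> = adj_transp i \<circ> \<tau>"

definition hecke_pi :: "nat list \<Rightarrow> nat \<Rightarrow> (filling \<Rightarrow>\<^sub>0 int) \<Rightarrow> (filling \<Rightarrow>\<^sub>0 int)" where
  "hecke_pi \<alpha> i = frag_extend (\<lambda>\<tau>.
     if i \<notin> Des \<alpha> \<tau> then frag_of \<tau>
     else if attacking \<alpha> \<tau> i then 0
     else frag_of (swap_entries i \<tau>))"

definition hecke_pi_word :: "nat list \<Rightarrow> nat list \<Rightarrow> (filling \<Rightarrow>\<^sub>0 int) \<Rightarrow> (filling \<Rightarrow>\<^sub>0 int)" where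
  "hecke_pi_word \<alpha> w = foldr (\<lambda>i f. hecke_pi \<alpha> i \<circ> f) w id"

text \<open>By the 0-Hecke relations the choice of the reduced word does not matter on \<open>SRCT \<alpha>\<close>.\<close>

definition hecke_pi_perm ::
    "nat list \<Rightarrow> (nat \<Rightarrow> nat) \<Rightarrow> (filling \<Rightarrow>\<^sub>0 int) \<Rightarrow> (filling \<Rightarrow>\<^sub>0 int)" where
  "hecke_pi_perm \<alpha> \<sigma> = hecke_pi_word \<alpha> (SOME w. reduced_word (sum_list \<alpha>) \<sigma> w)"

definition srct_le :: "nat list \<Rightarrow> filling \<Rightarrow> filling \<Rightarrow> bool" where
  "srct_le \<alpha> \<tau> \<tau>' \<longleftrightarrow>
     (\<exists>\<sigma>. \<sigma> permutes {1..sum_list \<alpha>} \<and> hecke_pi_perm \<alpha> \<sigma> (frag_of \<tau>) = frag_of \<tau>')"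

definition srct_poset :: "nat list \<Rightarrow> filling gorder" where
  "srct_poset \<alpha> = \<lparr>carrier = SRCT \<alpha>, eq = (=), le = srct_le \<alpha>\<rparr>"

definition max_part :: "nat list \<Rightarrow> nat" where
  "max_part \<alpha> = Max (insert 0 (set \<alpha>))"

definition column_entries :: "nat list \<Rightarrow> filling \<Rightarrow> nat \<Rightarrow> nat list" where
  "column_entries \<alpha> \<tau> j = map (\<lambda>i. \<tau> (i, j)) (filter (\<lambda>i. (i, j) \<in> diagram \<alpha>) [1..<length \<alpha> + 1])"

definition col_word :: "nat list \<Rightarrow> filling \<Rightarrow> nat list" where
  "col_word \<alpha> \<tau> = concat (map (column_entries \<alpha> \<tau>) [1..<max_part \<alpha> + 1])"

definition one_line :: "nat list \<Rightarrow> nat \<Rightarrow> nat" where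
  "one_line w p = (if 1 \<le> p \<and> p \<le> length w then w ! (p - 1) else p)"

definition col_perm :: "nat list \<Rightarrow> filling \<Rightarrow> nat \<Rightarrow> nat" where
  "col_perm \<alpha> \<tau> = one_line (col_word \<alpha> \<tau>)"

text \<open>The standardization of a word with distinct letters, as a permutation in one-line notation.\<close>

definition standardization :: "nat list \<Rightarrow> nat list" where
  "standardization w = (THE u. length u = length w \<and> set u = {1..length w} \<and>
     (\<forall>i < length w. \<forall>j < length w. u ! i < u ! j \<longleftrightarrow> w ! i < w ! j))"

definition st_col_word :: "nat list \<Rightarrow> filling \<Rightarrow> nat list" where
  "st_col_word \<alpha> \<tau> =
     concat (map (\<lambda>j. standardization (column_entries \<alpha> \<tau> j)) [1..<max_part \<alpha> + 1])"

definition srct_equiv :: "nat list \<Rightarrow> (filling \<times> filling) set" where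
  "srct_equiv \<alpha> = {(\<tau>, \<tau>'). \<tau> \<in> SRCT \<alpha> \<and> \<tau>' \<in> SRCT \<alpha> \<and> st_col_word \<alpha> \<tau> = st_col_word \<alpha> \<tau>'}"

definition source_of :: "nat list \<Rightarrow> filling set \<Rightarrow> filling" where
  "source_of \<alpha> E = (THE \<tau>. \<tau> \<in> E \<and> source_tableau \<alpha> \<tau>)"

definition sink_of :: "nat list \<Rightarrow> filling set \<Rightarrow> filling" where
  "sink_of \<alpha> E = (THE \<tau>. \<tau> \<in> E \<and> sink_tableau \<alpha> \<tau>)"

definition covered_by :: "('a, 'c) gorder_scheme \<Rightarrow> 'a \<Rightarrow> 'a \<Rightarrow> bool" where
  "covered_by L x y \<longleftrightarrow> x \<sqsubset>\<^bsub>L\<^esub> y \<and> \<not> (\<exists>z \<in> carrier L. x \<sqsubset>\<^bsub>L\<^esub> z \<and> z \<sqsubset>\<^bsub>L\<^esub> y)"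

definition graded_poset :: "('a, 'c) gorder_scheme \<Rightarrow> bool" where
  "graded_poset L \<longleftrightarrow> partial_order L \<and>
     (\<exists>rk :: 'a \<Rightarrow> nat. \<forall>x \<in> carrier L. \<forall>y \<in> carrier L.
        (x \<sqsubset>\<^bsub>L\<^esub> y \<longrightarrow> rk x < rk y) \<and> (covered_by L x y \<longrightarrow> rk y = rk x + 1))"

definition poset_isomorphic :: "('a, 'c) gorder_scheme \<Rightarrow> ('b, 'd) gorder_scheme \<Rightarrow> bool" where
  "poset_isomorphic L M \<longleftrightarrow> (\<exists>f. bij_betw f (carrier L) (carrier M) \<and> order_emb L M f)"

end

theory Submission
  imports Defs
begin

text \<open>
  Both orders turn out to be containment of inversion sets of column words.  If two tableaux of
  the same class are comparable in this sense, every permutation between their column words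
  inherits the relative order in the columns and all three tableau conditions from them, so it
  is again the column word of a tableau of the class, and every step of a saturated chain is an
  admissible exchange of a non-attacking descent.  Since the source tableau is the minimum and
  the sink tableau the maximum of the class, the class is the whole interval.
\<close>

section \<open>Inversion sets and the weak order\<close>

text \<open>Inversions are pairs of positions because left multiplication exchanges values: it
  leaves the positions alone and alters exactly one pair. Coxeter length is defined as a minimum and
  \<open>hecke_pi_perm\<close> through an arbitrary reduced word, so both are reduced to inversion
  counts before the orders can be compared. The conditions pass to intermediate fillings for
  different reasons. A decreasing row consists of inversions and is inherited from the smaller
  tableau. The premise of the triple rule is an inversion and is handed on to the larger tableau,
  where the rule applies; its conclusion compares two entries of one column, as does the condition
  on the first column, and so is fixed by the class. The lattice property is inherited from the
  whole symmetric group, where joins and meets have to be constructed: the class is convex with a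
  least and a greatest element, so it contains them.\<close>

definition inversions :: "nat \<Rightarrow> (nat \<Rightarrow> nat) \<Rightarrow> (nat \<times> nat) set" where
  "inversions n \<sigma> = {(p, q). 1 \<le> p \<and> p < q \<and> q \<le> n \<and> \<sigma> q < \<sigma> p}"

lemma adj_transp_less:
  "adj_transp i a < adj_transp i b \<longleftrightarrow> (a < b \<and> \<not> (a = i \<and> b = Suc i)) \<or> (a = Suc i \<and> b = i)"
  by (auto simp: adj_transp_def Transposition.transpose_def)

lemma adj_transp_permutes: "i \<in> {1..<n} \<Longrightarrow> adj_transp i permutes {1..n}"
  unfolding adj_transp_def by (intro permutes_swap_id) auto

lemma adj_transp_involutory [simp]: "adj_transp i \<circ> (adj_transp i \<circ> f) = f"
  by (auto simp: adj_transp_def fun_eq_iff)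

lemma adj_transp_simps [simp]: "adj_transp i i = Suc i" "adj_transp i (Suc i) = i"
  by (auto simp: adj_transp_def)

lemma word_perm_simps [simp]:
  "word_perm [] = id" "word_perm (i # w) = adj_transp i \<circ> word_perm w"
  by (simp_all add: word_perm_def)

lemma word_perm_append: "word_perm (v @ w) = word_perm v \<circ> word_perm w"
  by (induction v) (simp_all add: o_assoc)

lemma word_perm_permutes: "set w \<subseteq> {1..<n} \<Longrightarrow> word_perm w permutes {1..n}"
proof (induction w)
  case (Cons i w)
  then show ?case
    unfolding word_perm_simps by (intro permutes_compose adj_transp_permutes) auto
qed (simp add: permutes_id)

lemma finite_inversions [simp]: "finite (inversions n \<sigma>)"
  by (rule finite_subset[of _ "{1..n} \<times> {1..n}"]) (auto simp: inversions_def)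

lemma inversions_id [simp]: "inversions n id = {}"
  by (auto simp: inversions_def)

text \<open>No value lies between \<open>i\<close> and \<open>Suc i\<close>, so exchanging these two
  changes no comparison except the one at their own positions \<open>p\<close> and
  \<open>q\<close>.\<close>

lemma inversions_adj_transp:
  assumes "\<sigma> permutes {1..n}" "1 \<le> p" "p < q" "q \<le> n" "\<sigma> p = i" "\<sigma> q = Suc i"
  shows "inversions n (adj_transp i \<circ> \<sigma>) = insert (p, q) (inversions n \<sigma>)"
    and "(p, q) \<notin> inversions n \<sigma>"
proof -
  have inj: "\<sigma> x = \<sigma> y \<longleftrightarrow> x = y" for x y
    using permutes_inj[OF assms(1)] by (auto simp: inj_def)
  have "\<sigma> x = i \<longleftrightarrow> x = p" "\<sigma> x = Suc i \<longleftrightarrow> x = q" for x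
    using inj assms(5,6) by metis+
  then show "inversions n (adj_transp i \<circ> \<sigma>) = insert (p, q) (inversions n \<sigma>)"
    using assms by (auto simp: inversions_def adj_transp_less)
  show "(p, q) \<notin> inversions n \<sigma>"
    using assms by (auto simp: inversions_def)
qed

lemma inversions_adj_transp_cases [consumes 2, case_names up down]:
  assumes "\<sigma> permutes {1..n}" "i \<in> {1..<n}"
  obtains (up) p q where "1 \<le> p" "p < q" "q \<le> n" "\<sigma> p = i" "\<sigma> q = Suc i"
      "inversions n (adj_transp i \<circ> \<sigma>) = insert (p, q) (inversions n \<sigma>)"
      "(p, q) \<notin> inversions n \<sigma>"
    | (down) p q where "1 \<le> p" "p < q" "q \<le> n" "\<sigma> p = Suc i" "\<sigma> q = i"
      "inversions n \<sigma> = insert (p, q) (inversions n (adj_transp i \<circ> \<sigma>))"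
      "(p, q) \<notin> inversions n (adj_transp i \<circ> \<sigma>)"
proof -
  have "i \<in> \<sigma> ` {1..n}" "Suc i \<in> \<sigma> ` {1..n}"
    using assms permutes_image[OF assms(1)] by auto
  then obtain p q where pq: "p \<in> {1..n}" "q \<in> {1..n}" "\<sigma> p = i" "\<sigma> q = Suc i"
    by (metis imageE)
  then have "p \<noteq> q" by auto
  then consider "p < q" | "q < p" by linarith
  then show thesis
  proof cases
    case 1
    with pq show thesis
      using up inversions_adj_transp[OF assms(1)] by auto
  next
    case 2
    \<comment> \<open>A second exchange restores \<open>\<sigma>\<close>, so this is the previous
      case read from \<open>adj_transp i \<circ> \<sigma>\<close>.\<close>
    have "adj_transp i \<circ> \<sigma> permutes {1..n}"
      using assms by (intro permutes_compose adj_transp_permutes)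
    with 2 pq show thesis
      using down[of q p] inversions_adj_transp[of "adj_transp i \<circ> \<sigma>" n q p i] by auto
  qed
qed

text \<open>A strict increase of the count excludes the case \<open>down\<close>. In this way
  conditions on lengths are turned into containments of inversion sets.\<close>

lemma inversions_adj_transp_mono:
  assumes "\<sigma> permutes {1..n}" "i \<in> {1..<n}"
    and "card (inversions n \<sigma>) < card (inversions n (adj_transp i \<circ> \<sigma>))"
  shows "inversions n \<sigma> \<subseteq> inversions n (adj_transp i \<circ> \<sigma>)"
    and "card (inversions n (adj_transp i \<circ> \<sigma>)) = Suc (card (inversions n \<sigma>))"
proof -
  have "inversions n \<sigma> \<subseteq> inversions n (adj_transp i \<circ> \<sigma>) \<and>
    card (inversions n (adj_transp i \<circ> \<sigma>)) = Suc (card (inversions n \<sigma>))"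
    using assms(1,2)
  proof (cases rule: inversions_adj_transp_cases)
    case (up p q)
    then show ?thesis by auto
  next
    case (down p q)
    then have "card (inversions n \<sigma>) = Suc (card (inversions n (adj_transp i \<circ> \<sigma>)))"
      using card_insert_disjoint[OF finite_inversions down(7)] by simp
    then show ?thesis using assms(3) by linarith
  qed
  then show "inversions n \<sigma> \<subseteq> inversions n (adj_transp i \<circ> \<sigma>)"
    and "card (inversions n (adj_transp i \<circ> \<sigma>)) = Suc (card (inversions n \<sigma>))"
    by blast+
qed

text \<open>Each letter adds at most one inversion. For \<open>\<sigma> = id\<close> this bounds the
  length of a word from below by the number of inversions of its product.\<close>

lemma card_inversions_word_perm_le:
  assumes "\<sigma> permutes {1..n}" "set w \<subseteq> {1..<n}"
  shows "card (inversions n (word_perm w \<circ> \<sigma>)) \<le> card (inversions n \<sigma>) + length w"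
  using assms(2)
proof (induction w)
  case (Cons i w)
  have "word_perm w \<circ> \<sigma> permutes {1..n}"
    using Cons.prems assms(1) by (intro permutes_compose word_perm_permutes) auto
  then have "card (inversions n (adj_transp i \<circ> (word_perm w \<circ> \<sigma>)))
      \<le> Suc (card (inversions n (word_perm w \<circ> \<sigma>)))"
    using inversions_adj_transp_mono(2)[of "word_perm w \<circ> \<sigma>" n i] Cons.prems
    by (cases "card (inversions n (word_perm w \<circ> \<sigma>)) < card (inversions n (adj_transp i \<circ> (word_perm w \<circ> \<sigma>)))")
      auto
  also have "\<dots> \<le> card (inversions n \<sigma>) + length (i # w)"
    using Cons.IH Cons.prems by (auto simp del: o_apply)
  finally show ?case by (simp add: o_assoc del: o_apply)
qed simp

text \<open>Equality in \<open>card_inversions_word_perm_le\<close> leaves no room for a letter that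
  removes an inversion, so the inversion set grows at every letter.\<close>

lemma inversions_word_perm_mono:
  assumes "\<sigma> permutes {1..n}" "set w \<subseteq> {1..<n}"
    and "card (inversions n (word_perm w \<circ> \<sigma>)) = card (inversions n \<sigma>) + length w"
  shows "inversions n \<sigma> \<subseteq> inversions n (word_perm w \<circ> \<sigma>)"
  using assms(2,3)
proof (induction w)
  case (Cons i w)
  have perm: "word_perm w \<circ> \<sigma> permutes {1..n}"
    using Cons.prems assms(1) by (intro permutes_compose word_perm_permutes) auto
  have i: "i \<in> {1..<n}"
    using Cons.prems(1) by simp
  have eq: "word_perm (i # w) \<circ> \<sigma> = adj_transp i \<circ> (word_perm w \<circ> \<sigma>)"
    by (simp add: o_assoc)
  have le: "card (inversions n (word_perm w \<circ> \<sigma>)) \<le> card (inversions n \<sigma>) + length w"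
    using Cons.prems(1) by (intro card_inversions_word_perm_le assms(1)) simp
  with Cons.prems(2) have "card (inversions n (word_perm w \<circ> \<sigma>))
      < card (inversions n (adj_transp i \<circ> (word_perm w \<circ> \<sigma>)))"
    unfolding eq by (simp del: o_apply)
  note step = inversions_adj_transp_mono[OF perm i this]
  have "card (inversions n (word_perm w \<circ> \<sigma>)) = card (inversions n \<sigma>) + length w"
    using Cons.prems(2) step(2) unfolding eq by (simp del: o_apply)
  then have "inversions n \<sigma> \<subseteq> inversions n (word_perm w \<circ> \<sigma>)"
    using Cons.IH Cons.prems(1) by (simp del: o_apply)
  with step(1) show ?case
    unfolding eq by (rule subset_trans[rotated])
qed simp

section \<open>Saturated chains, Coxeter length and the weak order\<close>

lemma permutes_increasing_imp_id:
  assumes "f permutes {1..n}" "\<And>i. i \<in> {1..<n} \<Longrightarrow> f i < f (Suc i)"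
  shows "f = id"
proof -
  \<comment> \<open>The values grow by at least one at each place, starting from
    \<open>f 1 \<ge> 1\<close>; a permutation that lowers no point is the identity.\<close>
  have "i \<le> f i" if "i \<in> {1..n}" for i
    using that
  proof (induction i)
    case (Suc i)
    show ?case
    proof (cases "i = 0")
      case True
      then show ?thesis
        using permutes_in_image[OF assms(1), of 1] Suc.prems by auto
    next
      case False
      with Suc show ?thesis using assms(2)[of i] by fastforce
    qed
  qed simp
  then show ?thesis
    using assms(1) by (intro permutes_natset_ge[of _ "{1..n}"]) auto
qed

text \<open>The composite \<open>\<rho> \<circ> inv \<sigma>\<close> sends the value of
  \<open>\<sigma>\<close> at a position to the value of \<open>\<rho>\<close> there. If no adjacent
  exchange stays inside the inversions of \<open>\<rho>\<close>, it increases on consecutive values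
  and is the identity, contrary to \<open>\<sigma> \<noteq> \<rho>\<close>.\<close>

lemma inversions_subset_step:
  assumes "\<sigma> permutes {1..n}" "\<rho> permutes {1..n}" "inversions n \<sigma> \<subseteq> inversions n \<rho>" "\<sigma> \<noteq> \<rho>"
  obtains i where "i \<in> {1..<n}"
    "card (inversions n (adj_transp i \<circ> \<sigma>)) = Suc (card (inversions n \<sigma>))"
    "inversions n \<sigma> \<subseteq> inversions n (adj_transp i \<circ> \<sigma>)"
    "inversions n (adj_transp i \<circ> \<sigma>) \<subseteq> inversions n \<rho>"
proof (rule ccontr)
  assume none: "\<not> thesis"
  have "\<rho> \<circ> inv \<sigma> = id"
  proof (rule permutes_increasing_imp_id)
    show "\<rho> \<circ> inv \<sigma> permutes {1..n}"
      using assms by (intro permutes_compose permutes_inv)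
    fix i assume i: "i \<in> {1..<n}"
    have inv: "inv \<sigma> (\<sigma> x) = x" for x
      using permutes_inverses(2)[OF assms(1)] .
    from assms(1) i show "(\<rho> \<circ> inv \<sigma>) i < (\<rho> \<circ> inv \<sigma>) (Suc i)"
    proof (cases rule: inversions_adj_transp_cases)
      case (up p q)
      \<comment> \<open>Otherwise exchanging \<open>i\<close> and \<open>Suc i\<close> would be the
        step assumed not to exist.\<close>
      have "(p, q) \<notin> inversions n \<rho>"
        using up(6,7) none that[OF i] assms(3) by auto
      moreover have "\<rho> p \<noteq> \<rho> q"
        using permutes_inj[OF assms(2)] up(2) by (auto simp: inj_def)
      ultimately have "\<rho> p < \<rho> q"
        using up(1-3) by (auto simp: inversions_def)
      then show ?thesis using inv up(4,5) by (metis comp_apply)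
    next
      case (down p q)
      then have "\<rho> q < \<rho> p" using assms(3) by (auto simp: inversions_def)
      then show ?thesis using inv down(4,5) by (metis comp_apply)
    qed
  qed
  then have "\<rho> \<circ> inv \<sigma> \<circ> \<sigma> = \<sigma>" by simp
  then show False
    using assms(1,4) by (simp add: o_assoc[symmetric] permutes_inv_o)
qed

text \<open>From distinct \<open>\<sigma>\<close> and \<open>\<rho>\<close> a step upwards would
  lead to an inversion set with one more element, still contained in the set it started
  from.\<close>

lemma inversions_eq_imp_eq:
  assumes "\<sigma> permutes {1..n}" "\<rho> permutes {1..n}" "inversions n \<sigma> = inversions n \<rho>"
  shows "\<sigma> = \<rho>"
proof (rule ccontr)
  assume "\<sigma> \<noteq> \<rho>"
  moreover have "inversions n \<sigma> \<subseteq> inversions n \<rho>"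
    using assms(3) by simp
  ultimately obtain i where "card (inversions n (adj_transp i \<circ> \<sigma>)) = Suc (card (inversions n \<sigma>))"
    "inversions n (adj_transp i \<circ> \<sigma>) \<subseteq> inversions n \<rho>"
    by (metis inversions_subset_step[OF assms(1,2)])
  then show False
    using assms(3) card_mono[OF finite_inversions, of "inversions n (adj_transp i \<circ> \<sigma>)" n \<rho>] by simp
qed

text \<open>Steps are iterated with the number of missing inversions as measure. The first letter of
  \<open>is\<close> acts first, whence the reversals; the count is recorded for every prefix because
  the weak order asks for it.\<close>

lemma inversions_subset_chain:
  assumes "\<sigma> permutes {1..n}" "\<rho> permutes {1..n}" "inversions n \<sigma> \<subseteq> inversions n \<rho>"
  shows "\<exists>is. set is \<subseteq> {1..<n} \<and> \<rho> = word_perm (rev is) \<circ> \<sigma> \<and>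
    (\<forall>r \<le> length is. card (inversions n (word_perm (rev (take r is)) \<circ> \<sigma>)) = card (inversions n \<sigma>) + r)"
  using assms
proof (induction "card (inversions n \<rho>) - card (inversions n \<sigma>)" arbitrary: \<sigma> rule: less_induct)
  case less
  show ?case
  proof (cases "\<sigma> = \<rho>")
    case True
    then show ?thesis by (intro exI[of _ "[]"]) simp
  next
    case False
    then obtain i where i: "i \<in> {1..<n}"
      "card (inversions n (adj_transp i \<circ> \<sigma>)) = Suc (card (inversions n \<sigma>))"
      "inversions n (adj_transp i \<circ> \<sigma>) \<subseteq> inversions n \<rho>"
      by (metis inversions_subset_step[OF less.prems])
    have "card (inversions n (adj_transp i \<circ> \<sigma>)) \<le> card (inversions n \<rho>)"
      using i(3) by (simp add: card_mono)
    moreover have "adj_transp i \<circ> \<sigma> permutes {1..n}"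
      using less.prems(1) i(1) by (intro permutes_compose adj_transp_permutes)
    ultimately obtain js where js: "set js \<subseteq> {1..<n}"
      "\<rho> = word_perm (rev js) \<circ> (adj_transp i \<circ> \<sigma>)"
      "\<forall>r \<le> length js. card (inversions n (word_perm (rev (take r js)) \<circ> (adj_transp i \<circ> \<sigma>)))
          = card (inversions n (adj_transp i \<circ> \<sigma>)) + r"
      using less.hyps[OF _ _ less.prems(2) i(3)] i(2) by (metis Suc_le_eq diff_less_mono2 lessI)
    have "card (inversions n (word_perm (rev (take r (i # js))) \<circ> \<sigma>)) = card (inversions n \<sigma>) + r"
      if "r \<le> length (i # js)" for r
      using that js(3) i(2) by (cases r) (simp_all add: word_perm_append o_assoc)
    with js(1,2) i(1) show ?thesis
      by (intro exI[of _ "i # js"]) (auto simp: word_perm_append o_assoc)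
  qed
qed

lemma ex_word_of_length_inversions:
  assumes "\<sigma> permutes {1..n}"
  shows "\<exists>w. set w \<subseteq> {1..<n} \<and> word_perm w = \<sigma> \<and> length w = card (inversions n \<sigma>)"
proof -
  obtain js where js: "set js \<subseteq> {1..<n}" "\<sigma> = word_perm (rev js) \<circ> id"
    "\<forall>r \<le> length js. card (inversions n (word_perm (rev (take r js)) \<circ> id)) = card (inversions n id) + r"
    using inversions_subset_chain[of id n \<sigma>] assms permutes_id by auto
  then show ?thesis
    by (intro exI[of _ "rev js"]) (auto dest: spec[of _ "length js"])
qed

text \<open>A chain from the identity, which has no inversions, attains the lower bound that
  \<open>card_inversions_word_perm_le\<close> imposes on every word.\<close>

lemma cox_length_eq_card_inversions:
  assumes "\<sigma> permutes {1..n}"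
  shows "cox_length n \<sigma> = card (inversions n \<sigma>)"
  unfolding cox_length_def
proof (rule Least_equality)
  show "\<exists>w. set w \<subseteq> {1..<n} \<and> word_perm w = \<sigma> \<and> length w = card (inversions n \<sigma>)"
    using ex_word_of_length_inversions[OF assms] .
  fix k assume "\<exists>w. set w \<subseteq> {1..<n} \<and> word_perm w = \<sigma> \<and> length w = k"
  then show "card (inversions n \<sigma>) \<le> k"
    using card_inversions_word_perm_le[OF permutes_id[of "{1..n}"]] by fastforce
qed

lemma reduced_word_exists: "\<sigma> permutes {1..n} \<Longrightarrow> \<exists>w. reduced_word n \<sigma> w"
  using ex_word_of_length_inversions[of \<sigma> n]
  by (auto simp: reduced_word_def cox_length_eq_card_inversions)

lemma weak_bruhat_le_iff_inversions:
  assumes "\<sigma> permutes {1..n}" "\<rho> permutes {1..n}"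
  shows "weak_bruhat_le n \<sigma> \<rho> \<longleftrightarrow> inversions n \<sigma> \<subseteq> inversions n \<rho>"
proof
  assume "weak_bruhat_le n \<sigma> \<rho>"
  then obtain js where js: "set js \<subseteq> {1..<n}" "\<rho> = word_perm (rev js) \<circ> \<sigma>"
    "\<forall>r \<in> {1..length js}. cox_length n (word_perm (rev (take r js)) \<circ> \<sigma>) = cox_length n \<sigma> + r"
    unfolding weak_bruhat_le_def by blast
  \<comment> \<open>The definition says nothing about \<open>r = 0\<close>, so the empty chain is a
    separate case; otherwise the instance \<open>r = length js\<close> is the one that
    matters.\<close>
  have "card (inversions n \<rho>) = card (inversions n \<sigma>) + length js"
    using js(2,3) assms by (cases js) (auto simp: cox_length_eq_card_inversions dest: bspec[of _ _ "length js"])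
  then show "inversions n \<sigma> \<subseteq> inversions n \<rho>"
    using inversions_word_perm_mono[OF assms(1), of "rev js"] js(1,2) by simp
next
  assume "inversions n \<sigma> \<subseteq> inversions n \<rho>"
  then obtain js where js: "set js \<subseteq> {1..<n}" "\<rho> = word_perm (rev js) \<circ> \<sigma>"
    "\<forall>r \<le> length js. card (inversions n (word_perm (rev (take r js)) \<circ> \<sigma>)) = card (inversions n \<sigma>) + r"
    using inversions_subset_chain assms by blast
  have "word_perm (rev (take r js)) \<circ> \<sigma> permutes {1..n}" for r
    using js(1) set_take_subset[of r js] assms(1)
    by (intro permutes_compose word_perm_permutes) auto
  then show "weak_bruhat_le n \<sigma> \<rho>"
    unfolding weak_bruhat_le_def
    using js assms(1) by (intro exI[of _ js]) (auto simp: cox_length_eq_card_inversions)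
qed

text \<open>
  The join of two permutations has as inversion set the transitive closure of the union of
  their inversion sets; meets are obtained by complementation.
\<close>

definition position_pairs :: "nat \<Rightarrow> (nat \<times> nat) set" where
  "position_pairs n = {(p, q). 1 \<le> p \<and> p < q \<and> q \<le> n}"

text \<open>An intrinsic description of inversion sets: by \<open>biclosed_inversions\<close> and
  \<open>biclosed_is_inversions\<close> these are exactly the inversion sets, so a permutation can
  be obtained from a set of pairs.\<close>

definition biclosed :: "nat \<Rightarrow> (nat \<times> nat) set \<Rightarrow> bool" where
  "biclosed n A \<longleftrightarrow> A \<subseteq> position_pairs n \<and> trans A \<and> trans (position_pairs n - A)"

lemma biclosed_complement: "biclosed n A \<Longrightarrow> biclosed n (position_pairs n - A)"
  by (auto simp: biclosed_def double_diff)

lemma biclosed_inversions: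
  assumes "\<sigma> permutes {1..n}"
  shows "biclosed n (inversions n \<sigma>)"
proof -
  have eq: "position_pairs n - inversions n \<sigma> = {(p, q). 1 \<le> p \<and> p < q \<and> q \<le> n \<and> \<sigma> p \<le> \<sigma> q}"
    by (auto simp: position_pairs_def inversions_def)
  have "trans (position_pairs n - inversions n \<sigma>)"
    unfolding eq by (rule transI) auto
  moreover have "trans (inversions n \<sigma>)"
    by (rule transI) (auto simp: inversions_def)
  moreover have "inversions n \<sigma> \<subseteq> position_pairs n"
    by (auto simp: inversions_def position_pairs_def)
  ultimately show ?thesis by (simp add: biclosed_def)
qed

text \<open>Transitivity of the complement means that a pair \<open>(p, r)\<close> of the set and a
  position \<open>q\<close> in between always put \<open>(p, q)\<close> or \<open>(q, r)\<close>
  into the set. This splitting holds for \<open>A\<close> and \<open>B\<close>, hence for their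
  union, and extends to paths.\<close>

lemma biclosed_trancl_Un:
  assumes "biclosed n A" "biclosed n B"
  shows "biclosed n ((A \<union> B)\<^sup>+)"
proof -
  let ?C = "(A \<union> B)\<^sup>+"
  have pairs: "A \<union> B \<subseteq> position_pairs n" "trans (position_pairs n)"
    using assms by (auto simp: biclosed_def position_pairs_def intro!: transI)
  have sub: "?C \<subseteq> position_pairs n"
    using trancl_mono_subset[OF pairs(1)] trancl_id[OF pairs(2)] by simp
  have split: "(p, q) \<in> A \<union> B \<or> (q, r) \<in> A \<union> B" if "(p, r) \<in> A \<union> B" "p < q" "q < r" for p q r
  proof -
    have "(p, q) \<in> position_pairs n" "(q, r) \<in> position_pairs n"
      using that pairs(1) by (auto simp: position_pairs_def)
    with that(1) show ?thesis
      using assms unfolding biclosed_def by (auto dest: transD)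
  qed
  have "(p, q) \<in> ?C \<or> (q, r) \<in> ?C" if "(p, r) \<in> ?C" "p < q" "q < r" for p q r
    using that
  proof (induction arbitrary: q rule: trancl_induct)
    case (base y)
    then show ?case using split by blast
  next
    case (step y z)
    \<comment> \<open>Before the last intermediate vertex \<open>y\<close>, the path to
      \<open>y\<close> splits by induction; at \<open>y\<close>, the path passes through
      \<open>q\<close>; after \<open>y\<close>, the last edge splits.\<close>
    consider "q < y" | "q = y" | "y < q" by linarith
    then show ?case
    proof cases
      case 1
      with step show ?thesis by (meson trancl_into_trancl)
    next
      case 2
      with step show ?thesis by blast
    next
      case 3
      with step show ?thesis using split by (meson r_into_trancl trancl_into_trancl)
    qed
  qed
  then have "trans (position_pairs n - ?C)"
    by (auto simp: position_pairs_def intro!: transI; fastforce)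
  with sub show ?thesis
    by (simp add: biclosed_def)
qed

text \<open>The relation \<open>less\<close> prescribes how the values are to compare: the natural
  order of positions, reversed exactly on the pairs of \<open>A\<close>. It is a strict total order
  on \<open>{1..n}\<close>, and the permutation sends each position to its rank.\<close>

lemma biclosed_is_inversions:
  assumes "biclosed n A"
  obtains \<sigma> where "\<sigma> permutes {1..n}" "inversions n \<sigma> = A"
proof -
  define less where "less p q \<longleftrightarrow> (p < q \<and> (p, q) \<notin> A) \<or> (q < p \<and> (q, p) \<in> A)" for p q
  \<comment> \<open>Counting \<open>q\<close> itself lets the ranks start at 1.\<close>
  define \<sigma> where "\<sigma> q = (if q \<in> {1..n} then card {p \<in> {1..n}. less p q \<or> p = q} else q)" for q
  have cl: "(p, q) \<in> A \<Longrightarrow> (q, r) \<in> A \<Longrightarrow> (p, r) \<in> A" for p q r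
    using assms by (auto simp: biclosed_def dest: transD)
  have ccl: "(p, q) \<notin> A \<Longrightarrow> (q, r) \<notin> A \<Longrightarrow> (p, r) \<notin> A"
    if "1 \<le> p" "p < q" "q < r" "r \<le> n" for p q r
  proof -
    assume "(p, q) \<notin> A" "(q, r) \<notin> A"
    with that have "(p, r) \<in> position_pairs n - A"
      using assms unfolding biclosed_def
      by (intro transD[of "position_pairs n - A" p q r]) (auto simp: position_pairs_def)
    then show "(p, r) \<notin> A" by simp
  qed
  have less_trans: "less p r"
    if "less p q" "less q r" "p \<in> {1..n}" "q \<in> {1..n}" "r \<in> {1..n}" for p q r
  proof -
    have "p \<noteq> r" using that(1,2) by (auto simp: less_def)
    moreover have "p \<noteq> q" "q \<noteq> r" using that(1,2) by (auto simp: less_def)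
    \<comment> \<open>These are the six relative orders of three positions. Three use transitivity
      of \<open>A\<close> and three that of the complement: directly when the positions are
      monotone, by contradiction otherwise.\<close>
    ultimately consider "p < q" "q < r" | "p < r" "r < q" | "q < p" "p < r" | "q < r" "r < p"
      | "r < p" "p < q" | "r < q" "q < p"
      by linarith
    then show ?thesis
    proof cases
      case 1
      with that ccl[of p q r] show ?thesis by (auto simp: less_def)
    next
      case 2
      with that cl[of p r q] show ?thesis by (auto simp: less_def)
    next
      case 3
      with that cl[of q p r] show ?thesis by (auto simp: less_def)
    next
      case 4
      with that ccl[of q r p] show ?thesis by (auto simp: less_def)
    next
      case 5
      with that ccl[of r p q] show ?thesis by (auto simp: less_def)
    next
      case 6
      with that cl[of r q p] show ?thesis by (auto simp: less_def)
    qed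
  qed
  have irrefl: "\<not> less p p" for p by (simp add: less_def)
  have asym: "\<not> less q p" if "less p q" for p q
    using that by (auto simp: less_def)
  have mono: "\<sigma> p < \<sigma> q" if "less p q" "p \<in> {1..n}" "q \<in> {1..n}" for p q
  proof -
    have "{x \<in> {1..n}. less x p \<or> x = p} \<subset> {x \<in> {1..n}. less x q \<or> x = q}"
      using that less_trans[OF _ that(1)] asym[OF that(1)] irrefl[of q] by auto
    then show ?thesis
      using that by (simp add: \<sigma>_def psubset_card_mono)
  qed
  have total: "less p q \<or> less q p" if "p \<noteq> q" for p q
    using that by (auto simp: less_def)
  have iff: "\<sigma> p < \<sigma> q \<longleftrightarrow> less p q" if "p \<in> {1..n}" "q \<in> {1..n}" for p q
    using that mono total by (metis less_asym less_irrefl)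
  have "inj_on \<sigma> {1..n}"
    using iff total by (intro inj_onI) (metis less_irrefl)
  moreover have "\<sigma> ` {1..n} \<subseteq> {1..n}"
  proof
    fix y assume "y \<in> \<sigma> ` {1..n}"
    then obtain q where q: "q \<in> {1..n}" "y = card {p \<in> {1..n}. less p q \<or> p = q}"
      by (auto simp: \<sigma>_def)
    have "card {q} \<le> y" "y \<le> card {1..n}"
      unfolding q(2) using q(1) by (intro card_mono; auto)+
    then show "y \<in> {1..n}" by simp
  qed
  ultimately have "bij_betw \<sigma> {1..n} {1..n}"
    by (simp add: bij_betw_def endo_inj_surj)
  then have perm: "\<sigma> permutes {1..n}"
    by (rule bij_imp_permutes) (auto simp: \<sigma>_def)
  have "inversions n \<sigma> = A"
  proof (rule Set.set_eqI)
    fix z :: "nat \<times> nat"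
    obtain p q where z: "z = (p, q)" by fastforce
    have "(p, q) \<in> A \<Longrightarrow> 1 \<le> p \<and> p < q \<and> q \<le> n"
      using assms by (auto simp: biclosed_def position_pairs_def)
    then show "z \<in> inversions n \<sigma> \<longleftrightarrow> z \<in> A"
      unfolding z inversions_def using iff[of q p] by (auto simp: less_def)
  qed
  with perm show thesis by (rule that)
qed

text \<open>Minimality holds because the inversion set of an upper bound is itself transitive and so
  contains the closure.\<close>

lemma inversions_join:
  assumes "\<sigma> permutes {1..n}" "\<rho> permutes {1..n}"
  obtains \<mu> where "\<mu> permutes {1..n}"
    "inversions n \<sigma> \<subseteq> inversions n \<mu>" "inversions n \<rho> \<subseteq> inversions n \<mu>"
    "\<And>\<nu>. \<nu> permutes {1..n} \<Longrightarrow> inversions n \<sigma> \<subseteq> inversions n \<nu> \<Longrightarrow>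
      inversions n \<rho> \<subseteq> inversions n \<nu> \<Longrightarrow> inversions n \<mu> \<subseteq> inversions n \<nu>"
proof -
  let ?C = "(inversions n \<sigma> \<union> inversions n \<rho>)\<^sup>+"
  obtain \<mu> where \<mu>: "\<mu> permutes {1..n}" "inversions n \<mu> = ?C"
    using biclosed_is_inversions[OF biclosed_trancl_Un] biclosed_inversions assms by metis
  show thesis
  proof (rule that[OF \<mu>(1)])
    fix \<nu> assume \<nu>: "\<nu> permutes {1..n}" "inversions n \<sigma> \<subseteq> inversions n \<nu>" "inversions n \<rho> \<subseteq> inversions n \<nu>"
    then have "?C \<subseteq> (inversions n \<nu>)\<^sup>+"
      by (intro trancl_mono_subset) auto
    also have "\<dots> = inversions n \<nu>"
      using biclosed_inversions[OF \<nu>(1)] by (simp add: biclosed_def trancl_id)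
    finally show "inversions n \<mu> \<subseteq> inversions n \<nu>" by (simp add: \<mu>(2))
  qed (auto simp: \<mu>(2))
qed

lemma inversions_meet:
  assumes "\<sigma> permutes {1..n}" "\<rho> permutes {1..n}"
  obtains \<mu> where "\<mu> permutes {1..n}"
    "inversions n \<mu> \<subseteq> inversions n \<sigma>" "inversions n \<mu> \<subseteq> inversions n \<rho>"
    "\<And>\<nu>. \<nu> permutes {1..n} \<Longrightarrow> inversions n \<nu> \<subseteq> inversions n \<sigma> \<Longrightarrow>
      inversions n \<nu> \<subseteq> inversions n \<rho> \<Longrightarrow> inversions n \<nu> \<subseteq> inversions n \<mu>"
proof -
  let ?co = "\<lambda>\<sigma>. position_pairs n - inversions n \<sigma>"
  let ?C = "(?co \<sigma> \<union> ?co \<rho>)\<^sup>+"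
  have pairs: "inversions n \<nu> \<subseteq> position_pairs n" for \<nu>
    by (auto simp: inversions_def position_pairs_def)
  have "biclosed n (position_pairs n - ?C)"
    using assms by (intro biclosed_complement biclosed_trancl_Un biclosed_inversions)
  then obtain \<mu> where \<mu>: "\<mu> permutes {1..n}" "inversions n \<mu> = position_pairs n - ?C"
    using biclosed_is_inversions by metis
  show thesis
  proof (rule that[OF \<mu>(1)])
    fix \<nu> assume \<nu>: "\<nu> permutes {1..n}" "inversions n \<nu> \<subseteq> inversions n \<sigma>" "inversions n \<nu> \<subseteq> inversions n \<rho>"
    then have "?C \<subseteq> (?co \<nu>)\<^sup>+"
      by (intro trancl_mono_subset) auto
    also have "\<dots> = ?co \<nu>"
      using biclosed_inversions[OF \<nu>(1)] by (simp add: biclosed_def trancl_id)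
    finally show "inversions n \<nu> \<subseteq> inversions n \<mu>"
      using pairs by (auto simp: \<mu>(2))
  qed (auto simp: \<mu>(2))
qed

section \<open>Tableaux of an equivalence class\<close>

text \<open>Intermediate permutations at first yield only such fillings; the tableau conditions are
  derived afterwards from convexity.\<close>

definition fillings :: "nat list \<Rightarrow> filling set" where
  "fillings \<alpha> = {\<tau>. bij_betw \<tau> (diagram \<alpha>) {1..sum_list \<alpha>} \<and> (\<forall>c. c \<notin> diagram \<alpha> \<longrightarrow> \<tau> c = 0)}"

definition same_columns :: "nat list \<Rightarrow> filling \<Rightarrow> filling \<Rightarrow> bool" where
  "same_columns \<alpha> \<tau> \<rho> \<longleftrightarrow>
    (\<forall>i j k. (i, k) \<in> diagram \<alpha> \<and> (j, k) \<in> diagram \<alpha> \<longrightarrow> (\<tau> (i, k) < \<tau> (j, k) \<longleftrightarrow> \<rho> (i, k) < \<rho> (j, k)))"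

definition read_before :: "cell \<Rightarrow> cell \<Rightarrow> bool" where
  "read_before c d \<longleftrightarrow> snd c < snd d \<or> (snd c = snd d \<and> fst c < fst d)"

text \<open>Indexing by cells keeps the combinatorics of tableaux free of the numbering of
  positions; \<open>inversions_col_perm_subset_iff\<close> translates between the two.\<close>

definition cell_inversions :: "nat list \<Rightarrow> filling \<Rightarrow> (cell \<times> cell) set" where
  "cell_inversions \<alpha> \<tau> = {(c, d). c \<in> diagram \<alpha> \<and> d \<in> diagram \<alpha> \<and> read_before c d \<and> \<tau> d < \<tau> c}"

lemma SRCT_imp_fillings: "\<tau> \<in> SRCT \<alpha> \<Longrightarrow> \<tau> \<in> fillings \<alpha>"
  by (auto simp: SRCT_def fillings_def)

lemma filling_range: "\<tau> \<in> fillings \<alpha> \<Longrightarrow> c \<in> diagram \<alpha> \<Longrightarrow> \<tau> c \<in> {1..sum_list \<alpha>}"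
  by (auto simp: fillings_def bij_betw_def)

lemma filling_eq_iff:
  "\<tau> \<in> fillings \<alpha> \<Longrightarrow> c \<in> diagram \<alpha> \<Longrightarrow> d \<in> diagram \<alpha> \<Longrightarrow> \<tau> c = \<tau> d \<longleftrightarrow> c = d"
  by (auto simp: fillings_def bij_betw_def inj_on_def)

lemma cell_of_filling: "\<tau> \<in> fillings \<alpha> \<Longrightarrow> c \<in> diagram \<alpha> \<Longrightarrow> cell_of \<alpha> \<tau> (\<tau> c) = c"
  by (simp add: fillings_def bij_betw_def cell_of_def)

lemma
  assumes "\<tau> \<in> fillings \<alpha>" "m \<in> {1..sum_list \<alpha>}"
  shows filling_cell_of: "\<tau> (cell_of \<alpha> \<tau> m) = m"
    and cell_of_in_diagram: "cell_of \<alpha> \<tau> m \<in> diagram \<alpha>"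
proof -
  have "m \<in> \<tau> ` diagram \<alpha>"
    using assms by (simp add: fillings_def bij_betw_def)
  then show "\<tau> (cell_of \<alpha> \<tau> m) = m" "cell_of \<alpha> \<tau> m \<in> diagram \<alpha>"
    by (simp_all add: cell_of_def f_inv_into_f inv_into_into)
qed

lemma same_columns_refl [simp]: "same_columns \<alpha> \<tau> \<tau>"
  and same_columns_sym: "same_columns \<alpha> \<tau> \<rho> \<Longrightarrow> same_columns \<alpha> \<rho> \<tau>"
  and same_columns_trans: "same_columns \<alpha> \<tau> \<rho> \<Longrightarrow> same_columns \<alpha> \<rho> \<nu> \<Longrightarrow> same_columns \<alpha> \<tau> \<nu>"
  by (auto simp: same_columns_def)

lemma same_columns_less_iff:
  "same_columns \<alpha> \<tau> \<rho> \<Longrightarrow> c \<in> diagram \<alpha> \<Longrightarrow> d \<in> diagram \<alpha> \<Longrightarrow> snd c = snd d \<Longrightarrow> \<tau> c < \<tau> d \<longleftrightarrow> \<rho> c < \<rho> d"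
  by (cases c; cases d) (auto simp: same_columns_def)

lemma SRCT_row: "\<tau> \<in> SRCT \<alpha> \<Longrightarrow> j < k \<Longrightarrow> (i, j) \<in> diagram \<alpha> \<Longrightarrow> (i, k) \<in> diagram \<alpha> \<Longrightarrow> \<tau> (i, k) < \<tau> (i, j)"
  by (auto simp: SRCT_def)

lemma SRCT_first_column:
  assumes "\<tau> \<in> SRCT \<alpha>" "i < j" "(i, 1) \<in> diagram \<alpha>" "(j, 1) \<in> diagram \<alpha>"
  shows "\<tau> (i, 1) < \<tau> (j, 1)"
proof -
  have "\<forall>i j. i < j \<and> (i, 1) \<in> diagram \<alpha> \<and> (j, 1) \<in> diagram \<alpha> \<longrightarrow> \<tau> (i, 1) < \<tau> (j, 1)"
    using assms(1) unfolding SRCT_def mem_Collect_eq by (elim conjE)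
  then show ?thesis using assms(2-4) by blast
qed

lemma SRCT_triple:
  assumes "\<tau> \<in> SRCT \<alpha>" "i < j" "(i, k) \<in> diagram \<alpha>" "(j, k + 1) \<in> diagram \<alpha>" "\<tau> (j, k + 1) < \<tau> (i, k)"
  shows "(i, k + 1) \<in> diagram \<alpha>" "\<tau> (j, k + 1) < \<tau> (i, k + 1)"
proof -
  have "\<forall>i j k. i < j \<and> (i, k) \<in> diagram \<alpha> \<and> (j, k + 1) \<in> diagram \<alpha> \<and> \<tau> (i, k) > \<tau> (j, k + 1) \<longrightarrow>
      (i, k + 1) \<in> diagram \<alpha> \<and> \<tau> (i, k + 1) > \<tau> (j, k + 1)"
    using assms(1) unfolding SRCT_def mem_Collect_eq by (elim conjE)
  from this[rule_format, of i j k] assms(2-5)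
  show "(i, k + 1) \<in> diagram \<alpha>" "\<tau> (j, k + 1) < \<tau> (i, k + 1)" by blast+
qed

text \<open>The condition on the first column and the comparison concluded by the triple rule each
  concern a single column, and the existence of the cell concerns the shape alone. Only the rows and
  the premise of the triple rule remain to be supplied.\<close>

lemma SRCT_same_columnsI:
  assumes \<tau>: "\<tau> \<in> SRCT \<alpha>" and \<rho>: "\<rho> \<in> fillings \<alpha>" and same: "same_columns \<alpha> \<tau> \<rho>"
    and rows: "\<And>i j k. j < k \<Longrightarrow> (i, j) \<in> diagram \<alpha> \<Longrightarrow> (i, k) \<in> diagram \<alpha> \<Longrightarrow> \<rho> (i, k) < \<rho> (i, j)"
    and adjacent: "\<And>i j k. i < j \<Longrightarrow> (i, k) \<in> diagram \<alpha> \<Longrightarrow> (j, k + 1) \<in> diagram \<alpha> \<Longrightarrow>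
      \<rho> (j, k + 1) < \<rho> (i, k) \<Longrightarrow> \<tau> (j, k + 1) < \<tau> (i, k)"
  shows "\<rho> \<in> SRCT \<alpha>"
proof -
  have "\<rho> (i, 1) < \<rho> (j, 1)" if "i < j" "(i, 1) \<in> diagram \<alpha>" "(j, 1) \<in> diagram \<alpha>" for i j
    using SRCT_first_column[OF \<tau> that] same_columns_less_iff[OF same that(2,3)] by simp
  moreover have "(i, k + 1) \<in> diagram \<alpha> \<and> \<rho> (j, k + 1) < \<rho> (i, k + 1)"
    if ij: "i < j" "(i, k) \<in> diagram \<alpha>" "(j, k + 1) \<in> diagram \<alpha>" "\<rho> (j, k + 1) < \<rho> (i, k)" for i j k
  proof -
    have "\<tau> (j, k + 1) < \<tau> (i, k)" using adjacent ij by blast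
    note SRCT_triple[OF \<tau> ij(1-3) this]
    with same_columns_less_iff[OF same ij(3) this(1)] show ?thesis by simp
  qed
  ultimately show ?thesis
    using \<rho> rows unfolding SRCT_def fillings_def by blast
qed

text \<open>Within one column \<open>\<tau>\<close> and \<open>\<tau>'\<close> have the same
  inversions, which leaves no freedom for \<open>\<rho>\<close> between them.\<close>

lemma convex_SRCT:
  assumes "\<tau> \<in> SRCT \<alpha>" "\<tau>' \<in> SRCT \<alpha>" "same_columns \<alpha> \<tau> \<tau>'" "\<rho> \<in> fillings \<alpha>"
    and sub: "cell_inversions \<alpha> \<tau> \<subseteq> cell_inversions \<alpha> \<rho>" "cell_inversions \<alpha> \<rho> \<subseteq> cell_inversions \<alpha> \<tau>'"
  shows "\<rho> \<in> SRCT \<alpha>" "same_columns \<alpha> \<tau> \<rho>"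
proof -
  have up: "\<rho> d < \<rho> c" if "c \<in> diagram \<alpha>" "d \<in> diagram \<alpha>" "read_before c d" "\<tau> d < \<tau> c" for c d
    using sub(1) that by (auto simp: cell_inversions_def)
  have down: "\<tau>' d < \<tau>' c" if "c \<in> diagram \<alpha>" "d \<in> diagram \<alpha>" "read_before c d" "\<rho> d < \<rho> c" for c d
    using sub(2) that by (auto simp: cell_inversions_def)
  have "\<rho> (i, k) < \<rho> (j, k) \<longleftrightarrow> \<tau> (i, k) < \<tau> (j, k)"
    if c: "(i, k) \<in> diagram \<alpha>" "(j, k) \<in> diagram \<alpha>" for i j k
  proof -
    have gt: "\<rho> d < \<rho> c \<longleftrightarrow> \<tau> d < \<tau> c"
      if "c \<in> diagram \<alpha>" "d \<in> diagram \<alpha>" "read_before c d" "snd c = snd d" for c d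
      using up[OF that(1-3)] down[OF that(1-3)] same_columns_less_iff[OF assms(3) that(2,1)] that(4) by auto
    have lt: "\<rho> c < \<rho> d \<longleftrightarrow> \<tau> c < \<tau> d"
      if cd: "c \<in> diagram \<alpha>" "d \<in> diagram \<alpha>" "read_before c d" "snd c = snd d" for c d
    proof -
      have "c \<noteq> d" using cd(3) by (auto simp: read_before_def)
      then have "\<rho> c \<noteq> \<rho> d" "\<tau> c \<noteq> \<tau> d"
        using filling_eq_iff[OF assms(4) cd(1,2)] filling_eq_iff[OF SRCT_imp_fillings[OF assms(1)] cd(1,2)]
        by auto
      with gt[OF cd] show ?thesis by linarith
    qed
    consider "i = j" | "i < j" | "j < i" by linarith
    then show ?thesis
      using gt[of "(j, k)" "(i, k)"] lt[of "(i, k)" "(j, k)"] c by cases (auto simp: read_before_def)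
  qed
  then show same: "same_columns \<alpha> \<tau> \<rho>" by (auto simp: same_columns_def)
  show "\<rho> \<in> SRCT \<alpha>"
  \<comment> \<open>The transfer starts from the upper tableau \<open>\<tau>'\<close>, since the
    premise of the triple rule passes from \<open>\<rho>\<close> upwards; the rows come from
    \<open>\<tau>\<close>.\<close>
  proof (rule SRCT_same_columnsI[OF assms(2,4)])
    show "same_columns \<alpha> \<tau>' \<rho>"
      using same_columns_trans[OF same_columns_sym[OF assms(3)] same] .
    show "\<rho> (i, k) < \<rho> (i, j)" if "j < k" "(i, j) \<in> diagram \<alpha>" "(i, k) \<in> diagram \<alpha>" for i j k
      using up[of "(i, j)" "(i, k)"] SRCT_row[OF assms(1)] that by (auto simp: read_before_def)
    show "\<tau>' (j, k + 1) < \<tau>' (i, k)"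
      if "(i, k) \<in> diagram \<alpha>" "(j, k + 1) \<in> diagram \<alpha>" "\<rho> (j, k + 1) < \<rho> (i, k)" for i j k
      using down[of "(i, k)" "(j, k + 1)"] that by (auto simp: read_before_def)
  qed
qed

section \<open>Exchanging consecutive entries\<close>

lemma swap_entries_involutory [simp]: "swap_entries i (swap_entries i \<tau>) = \<tau>"
  by (simp add: swap_entries_def)

lemma swap_entries_fillings:
  assumes "\<tau> \<in> fillings \<alpha>" "i \<in> {1..<sum_list \<alpha>}"
  shows "swap_entries i \<tau> \<in> fillings \<alpha>"
proof -
  have "bij_betw (adj_transp i \<circ> \<tau>) (diagram \<alpha>) {1..sum_list \<alpha>}"
    using assms permutes_imp_bij[OF adj_transp_permutes[OF assms(2)]]
    by (auto simp: fillings_def intro: bij_betw_trans)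
  moreover have "adj_transp i 0 = 0"
    using assms(2) by (auto simp: adj_transp_def)
  ultimately show ?thesis
    using assms(1) by (auto simp: fillings_def swap_entries_def)
qed

lemma swap_entries_less:
  "swap_entries i \<tau> c < swap_entries i \<tau> d \<longleftrightarrow>
    (\<tau> c < \<tau> d \<and> \<not> (\<tau> c = i \<and> \<tau> d = Suc i)) \<or> (\<tau> c = Suc i \<and> \<tau> d = i)"
  by (simp add: swap_entries_def adj_transp_less)

lemma swap_entries_same_columns:
  assumes "\<tau> \<in> fillings \<alpha>" "col_of \<alpha> \<tau> i \<noteq> col_of \<alpha> \<tau> (i + 1)"
  shows "same_columns \<alpha> \<tau> (swap_entries i \<tau>)"
proof -
  have "col_of \<alpha> \<tau> (\<tau> (j, k)) = k" if "(j, k) \<in> diagram \<alpha>" for j k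
    using cell_of_filling[OF assms(1) that] by (simp add: col_of_def)
  with assms(2) show ?thesis
    unfolding same_columns_def swap_entries_less by (metis Suc_eq_plus1)
qed

lemma cell_inversions_swap_entries:
  assumes "\<tau> \<in> fillings \<alpha>" "i \<in> {1..<sum_list \<alpha>}"
    and "read_before (cell_of \<alpha> \<tau> i) (cell_of \<alpha> \<tau> (i + 1))"
  shows "cell_inversions \<alpha> (swap_entries i \<tau>) =
      insert (cell_of \<alpha> \<tau> i, cell_of \<alpha> \<tau> (i + 1)) (cell_inversions \<alpha> \<tau>)"
    and "(cell_of \<alpha> \<tau> i, cell_of \<alpha> \<tau> (i + 1)) \<notin> cell_inversions \<alpha> \<tau>"
proof -
  obtain c d where cd: "cell_of \<alpha> \<tau> i = c" "cell_of \<alpha> \<tau> (i + 1) = d"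
    by blast
  have val: "\<tau> c = i" "\<tau> d = Suc i" "c \<in> diagram \<alpha>" "d \<in> diagram \<alpha>"
    using filling_cell_of[OF assms(1)] cell_of_in_diagram[OF assms(1)] assms(2) cd by auto
  have iff: "\<tau> x = i \<longleftrightarrow> x = c" "\<tau> x = Suc i \<longleftrightarrow> x = d" if "x \<in> diagram \<alpha>" for x
    using filling_eq_iff[OF assms(1) that] val by metis+
  have "read_before c d" "\<not> read_before d c"
    using assms(3) cd by (auto simp: read_before_def)
  then have "(x, y) \<in> cell_inversions \<alpha> (swap_entries i \<tau>) \<longleftrightarrow>
      (x, y) \<in> insert (c, d) (cell_inversions \<alpha> \<tau>)" for x y
    using val iff[of x] iff[of y] unfolding cell_inversions_def swap_entries_less by auto
  then show "cell_inversions \<alpha> (swap_entries i \<tau>) =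
      insert (cell_of \<alpha> \<tau> i, cell_of \<alpha> \<tau> (i + 1)) (cell_inversions \<alpha> \<tau>)"
    unfolding cd by auto
  show "(cell_of \<alpha> \<tau> i, cell_of \<alpha> \<tau> (i + 1)) \<notin> cell_inversions \<alpha> \<tau>"
    unfolding cd using val by (simp add: cell_inversions_def)
qed

lemma Des_non_attacking_read_before:
  assumes "i \<in> Des \<alpha> \<tau>" "\<not> attacking \<alpha> \<tau> i"
  shows "read_before (cell_of \<alpha> \<tau> i) (cell_of \<alpha> \<tau> (i + 1))"
  using assms by (auto simp: Des_def attacking_def col_of_def read_before_def)

text \<open>Rows survive because no inversion is lost. A new premise of the triple rule could only
  come from the exchanged pair, standing in adjacent columns with \<open>i + 1\<close> in the lower
  row, and such a pair is attacking.\<close>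

lemma swap_entries_ascend:
  assumes \<tau>: "\<tau> \<in> SRCT \<alpha>" and i: "i \<in> Des \<alpha> \<tau>" and non_attacking: "\<not> attacking \<alpha> \<tau> i"
  shows "swap_entries i \<tau> \<in> SRCT \<alpha>" "same_columns \<alpha> \<tau> (swap_entries i \<tau>)"
    "cell_inversions \<alpha> \<tau> \<subset> cell_inversions \<alpha> (swap_entries i \<tau>)"
proof -
  have f: "\<tau> \<in> fillings \<alpha>" using \<tau> by (rule SRCT_imp_fillings)
  have i': "i \<in> {1..<sum_list \<alpha>}" using i by (simp add: Des_def)
  show same: "same_columns \<alpha> \<tau> (swap_entries i \<tau>)"
    using non_attacking by (intro swap_entries_same_columns f) (auto simp: attacking_def)
  note inv = cell_inversions_swap_entries[OF f i' Des_non_attacking_read_before[OF i non_attacking]]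
  then show "cell_inversions \<alpha> \<tau> \<subset> cell_inversions \<alpha> (swap_entries i \<tau>)"
    by blast
  show "swap_entries i \<tau> \<in> SRCT \<alpha>"
  proof (rule SRCT_same_columnsI[OF \<tau> swap_entries_fillings[OF f i'] same])
    fix a j k assume jk: "j < k" "(a, j) \<in> diagram \<alpha>" "(a, k) \<in> diagram \<alpha>"
    then have "((a, j), (a, k)) \<in> cell_inversions \<alpha> \<tau>"
      using SRCT_row[OF \<tau> jk] by (simp add: cell_inversions_def read_before_def)
    then show "swap_entries i \<tau> (a, k) < swap_entries i \<tau> (a, j)"
      using inv(1) by (auto simp: cell_inversions_def)
  next
    fix a b k
    assume ab: "a < b" "(a, k) \<in> diagram \<alpha>" "(b, k + 1) \<in> diagram \<alpha>"
      "swap_entries i \<tau> (b, k + 1) < swap_entries i \<tau> (a, k)"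
    have "\<not> (\<tau> (a, k) = i \<and> \<tau> (b, k + 1) = Suc i)"
    proof
      assume "\<tau> (a, k) = i \<and> \<tau> (b, k + 1) = Suc i"
      then have "cell_of \<alpha> \<tau> i = (a, k)" "cell_of \<alpha> \<tau> (i + 1) = (b, k + 1)"
        using cell_of_filling[OF f ab(2)] cell_of_filling[OF f ab(3)] by auto
      then show False
        using non_attacking ab(1) by (simp add: attacking_def col_of_def row_of_def)
    qed
    then show "\<tau> (b, k + 1) < \<tau> (a, k)"
      using ab(4) by (auto simp: swap_entries_less)
  qed
qed

text \<open>A converse of \<open>swap_entries_ascend\<close>. Entries of one column cannot be
  exchanged within a class. If \<open>i + 1\<close> stood in the next column and a lower row, the
  triple rule and the row condition for the exchanged filling would require an entry strictly
  between \<open>i\<close> and \<open>Suc i\<close>.\<close>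

lemma non_attacking_descentI:
  assumes "\<tau> \<in> SRCT \<alpha>" "swap_entries i \<tau> \<in> SRCT \<alpha>" "same_columns \<alpha> \<tau> (swap_entries i \<tau>)"
    and i: "i \<in> {1..<sum_list \<alpha>}"
    and before: "read_before (cell_of \<alpha> \<tau> i) (cell_of \<alpha> \<tau> (i + 1))"
  shows "i \<in> Des \<alpha> \<tau>" "\<not> attacking \<alpha> \<tau> i"
proof -
  let ?\<rho> = "swap_entries i \<tau>"
  obtain a k b l where cd: "cell_of \<alpha> \<tau> i = (a, k)" "cell_of \<alpha> \<tau> (i + 1) = (b, l)"
    by fastforce
  have f: "\<tau> \<in> fillings \<alpha>" using assms(1) by (rule SRCT_imp_fillings)
  have val: "\<tau> (a, k) = i" "\<tau> (b, l) = Suc i" "(a, k) \<in> diagram \<alpha>" "(b, l) \<in> diagram \<alpha>"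
    using filling_cell_of[OF f, of i] filling_cell_of[OF f, of "i + 1"]
      cell_of_in_diagram[OF f, of i] cell_of_in_diagram[OF f, of "i + 1"] i cd by auto
  then have swapped: "?\<rho> (a, k) = Suc i" "?\<rho> (b, l) = i"
    by (simp_all add: swap_entries_def)
  show "i \<in> Des \<alpha> \<tau>"
    using before i cd by (auto simp: Des_def col_of_def read_before_def)
  have "k \<noteq> l"
    using same_columns_less_iff[OF assms(3) val(3,4)] val swapped by auto
  moreover have "\<not> (l = k + 1 \<and> a < b)"
  proof
    assume l: "l = k + 1 \<and> a < b"
    then have "(a, k + 1) \<in> diagram \<alpha>" "i < ?\<rho> (a, k + 1)"
      using SRCT_triple[OF assms(2), of a b k] val swapped by auto
    moreover have "?\<rho> (a, k + 1) < Suc i"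
      using SRCT_row[OF assms(2), of k "k + 1" a] calculation(1) val swapped by simp
    ultimately show False by simp
  qed
  ultimately show "\<not> attacking \<alpha> \<tau> i"
    using cd by (simp add: attacking_def col_of_def row_of_def)
qed

text \<open>The exchange only removes an inversion, so no premise of the triple rule is created. A
  row could break only if it contained both entries; as they are not neighbours, a cell between them
  would hold a value strictly between \<open>i\<close> and \<open>Suc i\<close>.\<close>

lemma swap_entries_descend:
  assumes \<tau>: "\<tau> \<in> SRCT \<alpha>" and i: "i \<in> {1..<sum_list \<alpha>}" "i \<notin> Des \<alpha> \<tau>"
    and not_left: "\<not> (row_of \<alpha> \<tau> (i + 1) = row_of \<alpha> \<tau> i \<and> col_of \<alpha> \<tau> (i + 1) + 1 = col_of \<alpha> \<tau> i)"
  shows "swap_entries i \<tau> \<in> SRCT \<alpha>" "same_columns \<alpha> \<tau> (swap_entries i \<tau>)"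
    "cell_inversions \<alpha> (swap_entries i \<tau>) \<subset> cell_inversions \<alpha> \<tau>"
proof -
  let ?\<rho> = "swap_entries i \<tau>"
  have f: "\<tau> \<in> fillings \<alpha>" using \<tau> by (rule SRCT_imp_fillings)
  have f': "?\<rho> \<in> fillings \<alpha>" using f i(1) by (rule swap_entries_fillings)
  have col: "col_of \<alpha> \<tau> (i + 1) < col_of \<alpha> \<tau> i"
    using i by (auto simp: Des_def)
  show same: "same_columns \<alpha> \<tau> ?\<rho>"
    using col by (intro swap_entries_same_columns f) auto
  obtain a k b l where cd: "cell_of \<alpha> \<tau> i = (a, k)" "cell_of \<alpha> \<tau> (i + 1) = (b, l)"
    by fastforce
  have val: "\<tau> (a, k) = i" "\<tau> (b, l) = Suc i" "(a, k) \<in> diagram \<alpha>" "(b, l) \<in> diagram \<alpha>"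
    using filling_cell_of[OF f, of i] filling_cell_of[OF f, of "i + 1"]
      cell_of_in_diagram[OF f, of i] cell_of_in_diagram[OF f, of "i + 1"] i cd by auto
  have "?\<rho> (a, k) = Suc i" "?\<rho> (b, l) = i"
    using val by (simp_all add: swap_entries_def)
  then have "cell_of \<alpha> ?\<rho> i = (b, l)" "cell_of \<alpha> ?\<rho> (i + 1) = (a, k)"
    using cell_of_filling[OF f' val(3)] cell_of_filling[OF f' val(4)] by auto
  moreover have "l < k" using col cd by (simp add: col_of_def)
  ultimately have "read_before (cell_of \<alpha> ?\<rho> i) (cell_of \<alpha> ?\<rho> (i + 1))"
    by (simp add: read_before_def)
  then show sub: "cell_inversions \<alpha> ?\<rho> \<subset> cell_inversions \<alpha> \<tau>"
    using cell_inversions_swap_entries[OF f' i(1)] by auto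
  show "?\<rho> \<in> SRCT \<alpha>"
  proof (rule SRCT_same_columnsI[OF \<tau> f' same])
    fix r j m assume jm: "j < m" "(r, j) \<in> diagram \<alpha>" "(r, m) \<in> diagram \<alpha>"
    have "\<not> (\<tau> (r, m) = i \<and> \<tau> (r, j) = Suc i)"
    proof
      assume eq: "\<tau> (r, m) = i \<and> \<tau> (r, j) = Suc i"
      then have cells: "cell_of \<alpha> \<tau> i = (r, m)" "cell_of \<alpha> \<tau> (i + 1) = (r, j)"
        using cell_of_filling[OF f jm(2)] cell_of_filling[OF f jm(3)] by auto
      then have "j + 1 \<noteq> m"
        using not_left by (simp add: row_of_def col_of_def)
      then have "j < j + 1" "j + 1 < m" "(r, j + 1) \<in> diagram \<alpha>"
        using jm by (auto simp: diagram_def)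
      then have "\<tau> (r, m) < \<tau> (r, j + 1)" "\<tau> (r, j + 1) < \<tau> (r, j)"
        using SRCT_row[OF \<tau>] jm by blast+
      with eq show False by simp
    qed
    then show "?\<rho> (r, m) < ?\<rho> (r, j)"
      using SRCT_row[OF \<tau> jm] by (simp add: swap_entries_less)
  next
    fix r s m
    assume "(r, m) \<in> diagram \<alpha>" "(s, m + 1) \<in> diagram \<alpha>" "?\<rho> (s, m + 1) < ?\<rho> (r, m)"
    then have "((r, m), (s, m + 1)) \<in> cell_inversions \<alpha> ?\<rho>"
      by (simp add: cell_inversions_def read_before_def)
    then show "\<tau> (s, m + 1) < \<tau> (r, m)"
      using sub by (auto simp: cell_inversions_def)
  qed
qed

section \<open>Source and sink tableaux as extremal members of a class\<close>

text \<open>Applied to the column of an entry, it finds two consecutive entries between which a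
  given column boundary is crossed.\<close>

lemma ex_crossing:
  fixes P :: "nat \<Rightarrow> bool"
  assumes "P m" "\<not> P k" "m \<le> k"
  shows "\<exists>v. m \<le> v \<and> v < k \<and> P v \<and> \<not> P (Suc v)"
  using assms(3,2)
proof (induction rule: dec_induct)
  case base
  then show ?case using assms(1) by simp
next
  case (step k)
  then show ?case by (cases "P k") auto
qed

text \<open>
  Going through the entries in increasing order, a source tableau moves left only by one cell
  within a row; so some entry of column k is followed by its left neighbour whenever
  the entries pass from column k to the left of it.
\<close>

lemma source_tableau_least:
  assumes \<tau>: "\<tau> \<in> SRCT \<alpha>" "source_tableau \<alpha> \<tau>"
    and \<rho>: "\<rho> \<in> SRCT \<alpha>" "same_columns \<alpha> \<tau> \<rho>"
  shows "cell_inversions \<alpha> \<tau> \<subseteq> cell_inversions \<alpha> \<rho>"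
proof -
  have f: "\<tau> \<in> fillings \<alpha>" using \<tau>(1) by (rule SRCT_imp_fillings)
  have main: "\<rho> d < \<rho> c" if "c \<in> diagram \<alpha>" "d \<in> diagram \<alpha>" "snd c \<le> snd d" "\<tau> d < \<tau> c" for c d
    using that
  proof (induction "snd d" arbitrary: d rule: less_induct)
    case less
    show ?case
    proof (cases "snd c = snd d")
      case True
      then show ?thesis
        using same_columns_less_iff[OF \<rho>(2) less.prems(2,1)] less.prems(4) by simp
    next
      case False
      with less.prems(3) have lt: "snd c < snd d" by simp
      have "snd d \<le> col_of \<alpha> \<tau> (\<tau> d)" "\<not> snd d \<le> col_of \<alpha> \<tau> (\<tau> c)"
        using lt less.prems(1,2) by (simp_all add: col_of_def cell_of_filling[OF f])
      then obtain v where v: "\<tau> d \<le> v" "v < \<tau> c" "snd d \<le> col_of \<alpha> \<tau> v" "col_of \<alpha> \<tau> (Suc v) < snd d"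
        using ex_crossing[of "\<lambda>v. snd d \<le> col_of \<alpha> \<tau> v" "\<tau> d" "\<tau> c"] less.prems(4) by fastforce
      have range: "v \<in> {1..<sum_list \<alpha>}"
        using v(1,2) filling_range[OF f less.prems(1)] filling_range[OF f less.prems(2)] by auto
      have "v \<notin> Des \<alpha> \<tau>" using v(3,4) by (simp add: Des_def)
      then have adj: "row_of \<alpha> \<tau> (Suc v) = row_of \<alpha> \<tau> v" "col_of \<alpha> \<tau> (Suc v) + 1 = col_of \<alpha> \<tau> v"
        using \<tau>(2) range unfolding source_tableau_def by auto
      define e e' where "e = cell_of \<alpha> \<tau> v" and "e' = cell_of \<alpha> \<tau> (Suc v)"
      have e: "e \<in> diagram \<alpha>" "e' \<in> diagram \<alpha>" "\<tau> e = v" "\<tau> e' = Suc v"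
        using filling_cell_of[OF f] cell_of_in_diagram[OF f] range by (auto simp: e_def e'_def)
      have col: "snd e = snd d" "snd e' + 1 = snd d" "fst e' = fst e"
        using adj v(3,4) by (auto simp: e_def e'_def row_of_def col_of_def)
      \<comment> \<open>The three comparisons come from the common column order, from the row
        condition for \<open>\<rho>\<close>, and from the induction: \<open>e'\<close> lies one
        column to the left of \<open>d\<close>, but not to the left of \<open>c\<close>.\<close>
      have "\<rho> d \<le> \<rho> e"
        using same_columns_less_iff[OF \<rho>(2) e(1) less.prems(2)] col(1) v(1) e(3) by simp
      also have "\<dots> < \<rho> e'"
        using SRCT_row[OF \<rho>(1), of "snd e'" "snd e" "fst e"] e(1,2) col by (cases e; cases e') auto
      also have "\<dots> \<le> \<rho> c"
      proof (cases "c = e'")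
        case False
        then have "\<tau> e' < \<tau> c"
          using v(2) e(2,4) filling_eq_iff[OF f less.prems(1) e(2)] by simp
        then show ?thesis
          using less.hyps[of e'] less.prems(1) e(2) col(2) lt by simp
      qed simp
      finally show ?thesis .
    qed
  qed
  show ?thesis
    using main by (auto simp: cell_inversions_def read_before_def)
qed

text \<open>
  Dually, a sink tableau moves right only along attacking pairs, and the triple rule forces
  every tableau with the same relative order in the columns to order such a pair in the same way.
\<close>

lemma sink_tableau_greatest:
  assumes \<tau>: "\<tau> \<in> SRCT \<alpha>" "sink_tableau \<alpha> \<tau>"
    and \<rho>: "\<rho> \<in> SRCT \<alpha>" "same_columns \<alpha> \<tau> \<rho>"
  shows "cell_inversions \<alpha> \<rho> \<subseteq> cell_inversions \<alpha> \<tau>"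
proof -
  have f: "\<tau> \<in> fillings \<alpha>" "\<rho> \<in> fillings \<alpha>" using \<tau>(1) \<rho>(1) by (auto intro: SRCT_imp_fillings)
  have main: "\<rho> c < \<rho> d" if "c \<in> diagram \<alpha>" "d \<in> diagram \<alpha>" "snd c \<le> snd d" "\<tau> c < \<tau> d" for c d
    using that
  proof (induction "snd d - snd c" arbitrary: c rule: less_induct)
    case less
    show ?case
    proof (cases "snd c = snd d")
      case True
      then show ?thesis
        using same_columns_less_iff[OF \<rho>(2) less.prems(1,2)] less.prems(4) by simp
    next
      case False
      with less.prems(3) have lt: "snd c < snd d" by simp
      have "col_of \<alpha> \<tau> (\<tau> c) \<le> snd c" "\<not> col_of \<alpha> \<tau> (\<tau> d) \<le> snd c"
        using lt less.prems(1,2) by (simp_all add: col_of_def cell_of_filling[OF f(1)])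
      then obtain v where v: "\<tau> c \<le> v" "v < \<tau> d" "col_of \<alpha> \<tau> v \<le> snd c" "snd c < col_of \<alpha> \<tau> (Suc v)"
        using ex_crossing[of "\<lambda>v. col_of \<alpha> \<tau> v \<le> snd c" "\<tau> c" "\<tau> d"] less.prems(4) by fastforce
      have range: "v \<in> {1..<sum_list \<alpha>}"
        using v(1,2) filling_range[OF f(1) less.prems(1)] filling_range[OF f(1) less.prems(2)] by auto
      then have "v \<in> Des \<alpha> \<tau>" using v(3,4) by (simp add: Des_def)
      then have "attacking \<alpha> \<tau> v"
        using \<tau>(2) by (simp add: sink_tableau_def)
      then have adj: "row_of \<alpha> \<tau> v < row_of \<alpha> \<tau> (Suc v)" "col_of \<alpha> \<tau> (Suc v) = col_of \<alpha> \<tau> v + 1"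
        using v(3,4) by (auto simp: attacking_def)
      obtain a k b l where cells: "cell_of \<alpha> \<tau> v = (a, k)" "cell_of \<alpha> \<tau> (Suc v) = (b, l)"
        by fastforce
      with adj v(3,4) have k: "k = snd c" "l = k + 1" "a < b"
        by (auto simp: row_of_def col_of_def)
      have e: "(a, k) \<in> diagram \<alpha>" "(b, k + 1) \<in> diagram \<alpha>" "\<tau> (a, k) = v" "\<tau> (b, k + 1) = Suc v"
        using filling_cell_of[OF f(1), of v] filling_cell_of[OF f(1), of "Suc v"]
          cell_of_in_diagram[OF f(1), of v] cell_of_in_diagram[OF f(1), of "Suc v"] range cells k by auto
      have "\<rho> c \<le> \<rho> (a, k)"
        using same_columns_less_iff[OF \<rho>(2) e(1) less.prems(1)] k(1) v(1) e(3) by simp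
      \<comment> \<open>Otherwise the triple rule for \<open>\<rho>\<close> yields a cell
        \<open>(a, k + 1)\<close> with an entry larger than that of \<open>(b, k + 1)\<close>. The
        column order carries this over to \<open>\<tau>\<close>, where an entry above
        \<open>Suc v\<close> would stand to the right of \<open>v\<close> in row
        \<open>a\<close>.\<close>
      also have "\<dots> < \<rho> (b, k + 1)"
      proof (rule ccontr)
        assume "\<not> \<rho> (a, k) < \<rho> (b, k + 1)"
        moreover have "\<rho> (a, k) \<noteq> \<rho> (b, k + 1)"
          using filling_eq_iff[OF f(2) e(1,2)] by simp
        ultimately have "\<rho> (b, k + 1) < \<rho> (a, k)" by simp
        note triple = SRCT_triple[OF \<rho>(1) k(3) e(1,2) this]
        then have "Suc v < \<tau> (a, k + 1)"
          using same_columns_less_iff[OF \<rho>(2) e(2) triple(1)] e(4) by simp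
        moreover have "\<tau> (a, k + 1) < v"
          using SRCT_row[OF \<tau>(1) _ e(1) triple(1)] e(3) by simp
        ultimately show False by simp
      qed
      also have "\<dots> \<le> \<rho> d"
      proof (cases "d = (b, k + 1)")
        case False
        then have "\<tau> (b, k + 1) < \<tau> d"
          using v(2) e(2,4) filling_eq_iff[OF f(1) less.prems(2) e(2)] by simp
        moreover have "snd d - snd (b, k + 1) < snd d - snd c"
          unfolding snd_conv k(1) using lt by linarith
        ultimately have "\<rho> (b, k + 1) < \<rho> d"
          using less.hyps e(2) less.prems(2) k(1) lt by simp
        then show ?thesis by simp
      qed simp
      finally show ?thesis .
    qed
  qed
  have "\<tau> d < \<tau> c"
    if "c \<in> diagram \<alpha>" "d \<in> diagram \<alpha>" "read_before c d" "\<rho> d < \<rho> c" for c d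
    using main[OF that(1,2)] that(3,4) filling_eq_iff[OF f(1) that(1,2)]
    by (cases "\<tau> c" "\<tau> d" rule: linorder_cases) (auto simp: read_before_def)
  then show ?thesis
    by (auto simp: cell_inversions_def)
qed

section \<open>Column words\<close>

text \<open>An entry equals its rank, so a word on an initial segment is determined by its relative
  order; this gives uniqueness of the standardization.\<close>

lemma card_below_in_initial_segment:
  assumes "set u = {1..length u}" "i < length u"
  shows "card {j. j < length u \<and> u ! j \<le> u ! i} = (u ! i :: nat)"
proof -
  have dist: "distinct u" using assms(1) by (intro card_distinct) simp
  have "(!) u ` {j. j < length u \<and> u ! j \<le> u ! i} = {x \<in> set u. x \<le> u ! i}"
    by (auto simp: in_set_conv_nth)
  also have "\<dots> = {1..u ! i}"
    using assms nth_mem[OF assms(2)] by auto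
  finally have "card ((!) u ` {j. j < length u \<and> u ! j \<le> u ! i}) = u ! i" by simp
  moreover have "inj_on ((!) u) {j. j < length u \<and> u ! j \<le> u ! i}"
    using dist by (auto simp: inj_on_def nth_eq_iff_index_eq)
  ultimately show ?thesis by (simp add: card_image)
qed

text \<open>Existence comes from replacing each letter by its rank among the letters, uniqueness
  from \<open>card_below_in_initial_segment\<close>; together they justify the definite
  description.\<close>

lemma standardization_properties:
  assumes "distinct w"
  shows "length (standardization w) = length w \<and> set (standardization w) = {1..length w} \<and>
    (\<forall>i < length w. \<forall>j < length w. standardization w ! i < standardization w ! j \<longleftrightarrow> w ! i < w ! j)"
  unfolding standardization_def
proof (rule theI')
  let ?std = "\<lambda>u. length u = length w \<and> set u = {1..length w} \<and>
    (\<forall>i < length w. \<forall>j < length w. u ! i < u ! j \<longleftrightarrow> w ! i < w ! j)"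
  let ?f = "\<lambda>x. card {y \<in> set w. y \<le> x}"
  have mono: "?f x < ?f y" if "x < y" "y \<in> set w" for x y
  proof (rule psubset_card_mono)
    have "y \<in> {z \<in> set w. z \<le> y} - {z \<in> set w. z \<le> x}" using that by simp
    moreover have "{z \<in> set w. z \<le> x} \<subseteq> {z \<in> set w. z \<le> y}" using that(1) by auto
    ultimately show "{z \<in> set w. z \<le> x} \<subset> {z \<in> set w. z \<le> y}" by blast
  qed simp
  have iff: "?f x < ?f y \<longleftrightarrow> x < y" if "x \<in> set w" "y \<in> set w" for x y
    using mono[of x y] mono[of y x] that by (cases x y rule: linorder_cases) auto
  have inj: "inj_on ?f (set w)"
  proof (rule inj_onI)
    fix x y assume "x \<in> set w" "y \<in> set w" "?f x = ?f y"
    then show "x = y" using iff[of x y] iff[of y x] by simp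
  qed
  have "?f x \<in> {1..length w}" if "x \<in> set w" for x
  proof -
    have "card {x} \<le> ?f x" "?f x \<le> card (set w)"
      using that by (intro card_mono; auto)+
    then show ?thesis using distinct_card[OF assms] by simp
  qed
  then have "?f ` set w = {1..length w}"
    using card_image[OF inj] distinct_card[OF assms] by (intro card_subset_eq) auto
  then have ex: "?std (map ?f w)"
    using iff by simp
  have uniq: "u = v" if u: "?std u" and v: "?std v" for u v
  proof (rule nth_equalityI)
    show "length u = length v" using u v by simp
    fix i assume i: "i < length u"
    have "u ! j \<le> u ! i \<longleftrightarrow> v ! j \<le> v ! i" if "j < length w" for j
      using u v i that by (metis not_le)
    then have "{j. j < length u \<and> u ! j \<le> u ! i} = {j. j < length v \<and> v ! j \<le> v ! i}"
      using u v by auto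
    then show "u ! i = v ! i"
      using card_below_in_initial_segment[of u i] card_below_in_initial_segment[of v i] u v i by simp
  qed
  show "\<exists>!u. ?std u"
    using ex uniq by blast
qed

lemma standardization_eq_iff:
  assumes "distinct w" "distinct v" "length w = length v"
  shows "standardization w = standardization v \<longleftrightarrow>
    (\<forall>i < length w. \<forall>j < length w. w ! i < w ! j \<longleftrightarrow> v ! i < v ! j)"
proof
  assume "standardization w = standardization v"
  then show "\<forall>i < length w. \<forall>j < length w. w ! i < w ! j \<longleftrightarrow> v ! i < v ! j"
    using standardization_properties[OF assms(1)] standardization_properties[OF assms(2)] assms(3)
    by metis
next
  assume same: "\<forall>i < length w. \<forall>j < length w. w ! i < w ! j \<longleftrightarrow> v ! i < v ! j"
  show "standardization w = standardization v"
    unfolding standardization_def using same assms(3)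
    by (intro arg_cong[where f = The] ext conj_cong refl) auto
qed

section \<open>The reading order of the cells\<close>

definition column_rows :: "nat list \<Rightarrow> nat \<Rightarrow> nat list" where
  "column_rows \<alpha> j = filter (\<lambda>i. (i, j) \<in> diagram \<alpha>) [1..<length \<alpha> + 1]"

text \<open>This list depends on the shape alone, so that every column word is the image
  \<open>map \<tau> (reading \<alpha>)\<close> of one fixed list.\<close>

definition reading :: "nat list \<Rightarrow> cell list" where
  "reading \<alpha> = concat (map (\<lambda>j. map (\<lambda>i. (i, j)) (column_rows \<alpha> j)) [1..<max_part \<alpha> + 1])"

text \<open>Positions count from 1 as in \<open>one_line\<close>, list indices from 0.\<close>

definition cell_at :: "nat list \<Rightarrow> nat \<Rightarrow> cell" where
  "cell_at \<alpha> p = reading \<alpha> ! (p - 1)"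

lemma set_column_rows: "set (column_rows \<alpha> j) = {i. (i, j) \<in> diagram \<alpha>}"
  by (auto simp: column_rows_def diagram_def)

lemma diagram_column_bound: "(i, j) \<in> diagram \<alpha> \<Longrightarrow> 1 \<le> j \<and> j \<le> max_part \<alpha>"
proof -
  assume "(i, j) \<in> diagram \<alpha>"
  then have "1 \<le> j" "j \<le> \<alpha> ! (i - 1)" "\<alpha> ! (i - 1) \<in> set \<alpha>"
    by (auto simp: diagram_def)
  moreover have "\<alpha> ! (i - 1) \<le> max_part \<alpha>"
    using calculation(3) by (simp add: max_part_def)
  ultimately show ?thesis by simp
qed

text \<open>The blocks of the concatenation have lengths fixed by the shape, so equality can be
  tested column by column.\<close>

lemma st_col_word_eq_iff:
  assumes "\<tau> \<in> fillings \<alpha>" "\<rho> \<in> fillings \<alpha>"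
  shows "st_col_word \<alpha> \<tau> = st_col_word \<alpha> \<rho> \<longleftrightarrow> same_columns \<alpha> \<tau> \<rho>"
proof -
  have entries: "column_entries \<alpha> \<nu> j = map (\<lambda>i. \<nu> (i, j)) (column_rows \<alpha> j)" for \<nu> j
    by (simp add: column_entries_def column_rows_def)
  have dist: "distinct (column_entries \<alpha> \<nu> j)" if "\<nu> \<in> fillings \<alpha>" for \<nu> j
    using filling_eq_iff[OF that] unfolding entries
    by (auto simp: distinct_map inj_on_def set_column_rows) (simp add: column_rows_def)
  have len: "length (standardization (column_entries \<alpha> \<nu> j)) = length (column_rows \<alpha> j)"
    if "\<nu> \<in> fillings \<alpha>" for \<nu> j
    using standardization_properties[OF dist[OF that]] by (simp add: entries)
  have "standardization (column_entries \<alpha> \<tau> j) = standardization (column_entries \<alpha> \<rho> j) \<longleftrightarrow>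
      (\<forall>x \<in> set (column_rows \<alpha> j). \<forall>y \<in> set (column_rows \<alpha> j). \<tau> (x, j) < \<tau> (y, j) \<longleftrightarrow> \<rho> (x, j) < \<rho> (y, j))" for j
    using standardization_eq_iff[OF dist[OF assms(1)] dist[OF assms(2)], of j j]
    by (simp add: entries all_set_conv_all_nth)
  moreover have "st_col_word \<alpha> \<tau> = st_col_word \<alpha> \<rho> \<longleftrightarrow>
      (\<forall>j \<in> {1..<max_part \<alpha> + 1}. standardization (column_entries \<alpha> \<tau> j) = standardization (column_entries \<alpha> \<rho> j))"
    unfolding st_col_word_def
    by (subst concat_eq_concat_iff) (auto simp: zip_map_map zip_same_conv_map len assms)
  moreover have "same_columns \<alpha> \<tau> \<rho> \<longleftrightarrow> (\<forall>j \<in> {1..<max_part \<alpha> + 1}.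
      \<forall>x \<in> set (column_rows \<alpha> j). \<forall>y \<in> set (column_rows \<alpha> j). \<tau> (x, j) < \<tau> (y, j) \<longleftrightarrow> \<rho> (x, j) < \<rho> (y, j))"
    unfolding same_columns_def set_column_rows using diagram_column_bound by fastforce
  ultimately show ?thesis by simp
qed

lemma sorted_wrt_concat_map:
  assumes "\<And>x. x \<in> set xs \<Longrightarrow> sorted_wrt R (f x)" "sorted_wrt Q xs"
    and "\<And>x y a b. Q x y \<Longrightarrow> a \<in> set (f x) \<Longrightarrow> b \<in> set (f y) \<Longrightarrow> R a b"
  shows "sorted_wrt R (concat (map f xs))"
  using assms(1,2) by (induction xs) (auto simp: sorted_wrt_append intro: assms(3))

lemma set_reading: "set (reading \<alpha>) = diagram \<alpha>"
proof -
  have "set (reading \<alpha>) = (\<Union>j \<in> {1..<max_part \<alpha> + 1}. (\<lambda>i. (i, j)) ` {i. (i, j) \<in> diagram \<alpha>})"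
    unfolding reading_def by (simp add: set_column_rows del: upt_Suc)
  also have "\<dots> = diagram \<alpha>"
  proof (intro equalityI subrelI)
    fix i j assume ij: "(i, j) \<in> diagram \<alpha>"
    then have "j \<in> {1..<max_part \<alpha> + 1}" using diagram_column_bound by fastforce
    with ij show "(i, j) \<in> (\<Union>j \<in> {1..<max_part \<alpha> + 1}. (\<lambda>i. (i, j)) ` {i. (i, j) \<in> diagram \<alpha>})"
      by blast
  qed auto
  finally show ?thesis .
qed

lemma sorted_reading: "sorted_wrt read_before (reading \<alpha>)"
  unfolding reading_def
proof (rule sorted_wrt_concat_map)
  show "sorted_wrt (<) [1..<max_part \<alpha> + 1]" by (rule sorted_wrt_upt)
  fix j
  have "sorted_wrt (<) (column_rows \<alpha> j)"
    unfolding column_rows_def by (intro sorted_wrt_filter sorted_wrt_upt)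
  then show "sorted_wrt read_before (map (\<lambda>i. (i, j)) (column_rows \<alpha> j))"
    by (simp add: sorted_wrt_map read_before_def)
qed (auto simp: read_before_def)

lemma distinct_reading: "distinct (reading \<alpha>)"
  using sorted_wrt_nth_less[OF sorted_reading]
  by (intro distinct_conv_nth[THEN iffD2]) (metis less_irrefl linorder_neqE_nat read_before_def)

text \<open>The filling serves to count the cells, being a bijection from the diagram onto
  \<open>{1..sum_list \<alpha>}\<close>.\<close>

lemma length_reading:
  assumes "\<tau> \<in> fillings \<alpha>"
  shows "length (reading \<alpha>) = sum_list \<alpha>"
proof -
  have "length (reading \<alpha>) = card (diagram \<alpha>)"
    using distinct_card[OF distinct_reading] set_reading by metis
  also have "\<dots> = sum_list \<alpha>"
    using assms bij_betw_same_card by (fastforce simp: fillings_def)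
  finally show ?thesis .
qed

lemma col_word_eq: "col_word \<alpha> \<tau> = map \<tau> (reading \<alpha>)"
  by (simp add: col_word_def column_entries_def[abs_def] reading_def column_rows_def map_concat comp_def del: upt_Suc)

lemma cell_at_image:
  assumes "\<tau> \<in> fillings \<alpha>"
  shows "cell_at \<alpha> ` {1..sum_list \<alpha>} = diagram \<alpha>"
proof -
  have "cell_at \<alpha> ` {1..sum_list \<alpha>} = cell_at \<alpha> ` Suc ` {0..<length (reading \<alpha>)}"
    by (simp only: length_reading[OF assms] image_Suc_atLeastLessThan atLeastLessThanSuc_atLeastAtMost One_nat_def)
  also have "\<dots> = set (reading \<alpha>)"
    by (simp add: cell_at_def image_image set_conv_nth) (force simp: image_def)
  finally show ?thesis by (simp add: set_reading)
qed

lemma read_before_cell_at: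
  assumes "\<tau> \<in> fillings \<alpha>" "p \<in> {1..sum_list \<alpha>}" "q \<in> {1..sum_list \<alpha>}"
  shows "read_before (cell_at \<alpha> p) (cell_at \<alpha> q) \<longleftrightarrow> p < q"
proof -
  have less: "read_before (cell_at \<alpha> p) (cell_at \<alpha> q)"
    if "p < q" "p \<in> {1..sum_list \<alpha>}" "q \<in> {1..sum_list \<alpha>}" for p q
    unfolding cell_at_def
    using that length_reading[OF assms(1)] by (intro sorted_wrt_nth_less[OF sorted_reading]) auto
  show ?thesis
    using less[of p q] less[of q p] assms(2,3)
    by (cases p q rule: linorder_cases) (auto simp: read_before_def)
qed

lemma inj_on_cell_at:
  assumes "\<tau> \<in> fillings \<alpha>"
  shows "inj_on (cell_at \<alpha>) {1..sum_list \<alpha>}"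
  using read_before_cell_at[OF assms]
  by (intro inj_onI) (metis less_irrefl linorder_neqE_nat read_before_def)

section \<open>Fillings as permutations\<close>

lemma col_perm_eq:
  assumes "\<tau> \<in> fillings \<alpha>"
  shows "col_perm \<alpha> \<tau> p = (if p \<in> {1..sum_list \<alpha>} then \<tau> (cell_at \<alpha> p) else p)"
  using length_reading[OF assms] by (auto simp: col_perm_def one_line_def col_word_eq cell_at_def)

lemma col_perm_permutes:
  assumes "\<tau> \<in> fillings \<alpha>"
  shows "col_perm \<alpha> \<tau> permutes {1..sum_list \<alpha>}"
proof (rule bij_imp_permutes)
  have "bij_betw (cell_at \<alpha>) {1..sum_list \<alpha>} (diagram \<alpha>)"
    using inj_on_cell_at[OF assms] cell_at_image[OF assms] by (simp add: bij_betw_def)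
  then have "bij_betw (\<tau> \<circ> cell_at \<alpha>) {1..sum_list \<alpha>} {1..sum_list \<alpha>}"
    using assms by (auto simp: fillings_def intro: bij_betw_trans)
  then show "bij_betw (col_perm \<alpha> \<tau>) {1..sum_list \<alpha>} {1..sum_list \<alpha>}"
    by (rule bij_betw_cong[THEN iffD1, rotated]) (simp add: col_perm_eq[OF assms])
qed (auto simp: col_perm_eq[OF assms])

lemma col_perm_eq_iff:
  assumes "\<tau> \<in> fillings \<alpha>" "\<rho> \<in> fillings \<alpha>"
  shows "col_perm \<alpha> \<tau> = col_perm \<alpha> \<rho> \<longleftrightarrow> \<tau> = \<rho>"
proof
  assume eq: "col_perm \<alpha> \<tau> = col_perm \<alpha> \<rho>"
  have "\<tau> c = \<rho> c" for c
  proof (cases "c \<in> diagram \<alpha>")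
    case True
    then obtain p where "p \<in> {1..sum_list \<alpha>}" "c = cell_at \<alpha> p"
      using cell_at_image[OF assms(1)] by blast
    then show ?thesis
      using fun_cong[OF eq, of p] assms by (simp add: col_perm_eq del: One_nat_def)
  next
    case False
    then show ?thesis using assms by (cases c) (simp add: fillings_def)
  qed
  then show "\<tau> = \<rho>" by blast
qed simp

text \<open>Together with \<open>col_perm_eq_iff\<close> this identifies fillings with permutations,
  so constructions in the symmetric group yield fillings. The given filling guarantees that
  \<open>cell_at\<close> numbers the cells bijectively.\<close>

lemma ex_filling_of_permutation:
  assumes "\<tau> \<in> fillings \<alpha>" "\<sigma> permutes {1..sum_list \<alpha>}"
  shows "\<exists>\<rho> \<in> fillings \<alpha>. col_perm \<alpha> \<rho> = \<sigma>"
proof -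
  let ?I = "{1..sum_list \<alpha>}"
  define position where "position = inv_into ?I (cell_at \<alpha>)"
  define \<rho> where "\<rho> c = (if c \<in> diagram \<alpha> then \<sigma> (position c) else 0)" for c
  have "bij_betw position (diagram \<alpha>) ?I"
    unfolding position_def using inj_on_cell_at[OF assms(1)] cell_at_image[OF assms(1)]
    by (intro bij_betw_inv_into) (simp add: bij_betw_def)
  then have "bij_betw (\<sigma> \<circ> position) (diagram \<alpha>) ?I"
    using permutes_imp_bij[OF assms(2)] by (rule bij_betw_trans)
  then have "bij_betw \<rho> (diagram \<alpha>) ?I"
    by (rule bij_betw_cong[THEN iffD1, rotated]) (simp add: \<rho>_def)
  then have fill: "\<rho> \<in> fillings \<alpha>"
    by (simp add: fillings_def \<rho>_def)
  have "col_perm \<alpha> \<rho> p = \<sigma> p" for p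
  proof (cases "p \<in> ?I")
    case True
    then have "cell_at \<alpha> p \<in> diagram \<alpha>" using cell_at_image[OF assms(1)] by blast
    then show ?thesis
      using True inj_on_cell_at[OF assms(1)] by (simp add: col_perm_eq[OF fill] \<rho>_def position_def del: One_nat_def)
  next
    case False
    then show ?thesis
      using permutes_not_in[OF assms(2) False] by (simp only: col_perm_eq[OF fill] if_False)
  qed
  with fill show ?thesis by (intro bexI[of _ \<rho>]) auto
qed

lemma inversions_col_perm:
  assumes "\<tau> \<in> fillings \<alpha>"
  shows "inversions (sum_list \<alpha>) (col_perm \<alpha> \<tau>) = {(p, q). p \<in> {1..sum_list \<alpha>} \<and> q \<in> {1..sum_list \<alpha>} \<and>
    (cell_at \<alpha> p, cell_at \<alpha> q) \<in> cell_inversions \<alpha> \<tau>}"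
proof -
  have "(p, q) \<in> inversions (sum_list \<alpha>) (col_perm \<alpha> \<tau>) \<longleftrightarrow> (p \<in> {1..sum_list \<alpha>} \<and> q \<in> {1..sum_list \<alpha>} \<and>
    (cell_at \<alpha> p, cell_at \<alpha> q) \<in> cell_inversions \<alpha> \<tau>)" for p q
  proof (cases "p \<in> {1..sum_list \<alpha>} \<and> q \<in> {1..sum_list \<alpha>}")
    case True
    then have "cell_at \<alpha> p \<in> diagram \<alpha>" "cell_at \<alpha> q \<in> diagram \<alpha>"
      using cell_at_image[OF assms] by blast+
    with True show ?thesis
      using read_before_cell_at[OF assms, of p q]
      by (simp add: inversions_def cell_inversions_def col_perm_eq[OF assms])
  qed (auto simp: inversions_def)
  then show ?thesis by auto
qed

text \<open>The numbering \<open>cell_at\<close> carries the order of positions to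
  \<open>read_before\<close> and reaches every cell, so no inversion is lost in either
  direction.\<close>

lemma inversions_col_perm_subset_iff:
  assumes "\<tau> \<in> fillings \<alpha>" "\<rho> \<in> fillings \<alpha>"
  shows "inversions (sum_list \<alpha>) (col_perm \<alpha> \<tau>) \<subseteq> inversions (sum_list \<alpha>) (col_perm \<alpha> \<rho>) \<longleftrightarrow>
    cell_inversions \<alpha> \<tau> \<subseteq> cell_inversions \<alpha> \<rho>"
proof
  assume sub: "inversions (sum_list \<alpha>) (col_perm \<alpha> \<tau>) \<subseteq> inversions (sum_list \<alpha>) (col_perm \<alpha> \<rho>)"
  show "cell_inversions \<alpha> \<tau> \<subseteq> cell_inversions \<alpha> \<rho>"
  proof (rule subrelI)
    fix c d assume cd: "(c, d) \<in> cell_inversions \<alpha> \<tau>"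
    then have "c \<in> diagram \<alpha>" "d \<in> diagram \<alpha>" by (auto simp: cell_inversions_def)
    then obtain p q where "p \<in> {1..sum_list \<alpha>}" "q \<in> {1..sum_list \<alpha>}" "c = cell_at \<alpha> p" "d = cell_at \<alpha> q"
      using cell_at_image[OF assms(1)] by blast
    with cd sub show "(c, d) \<in> cell_inversions \<alpha> \<rho>"
      unfolding inversions_col_perm[OF assms(1)] inversions_col_perm[OF assms(2)] by blast
  qed
next
  assume "cell_inversions \<alpha> \<tau> \<subseteq> cell_inversions \<alpha> \<rho>"
  then show "inversions (sum_list \<alpha>) (col_perm \<alpha> \<tau>) \<subseteq> inversions (sum_list \<alpha>) (col_perm \<alpha> \<rho>)"
    unfolding inversions_col_perm[OF assms(1)] inversions_col_perm[OF assms(2)] by blast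
qed

lemma cell_inversions_eq_imp_eq:
  assumes "\<tau> \<in> fillings \<alpha>" "\<rho> \<in> fillings \<alpha>" "cell_inversions \<alpha> \<tau> = cell_inversions \<alpha> \<rho>"
  shows "\<tau> = \<rho>"
proof -
  have "col_perm \<alpha> \<tau> = col_perm \<alpha> \<rho>"
    using assms by (intro inversions_eq_imp_eq[OF col_perm_permutes col_perm_permutes])
      (simp_all add: inversions_col_perm)
  then show ?thesis using assms(1,2) by (simp add: col_perm_eq_iff)
qed

text \<open>The exchange acts on values, hence by multiplication from the left; this links the
  operators to the left weak order.\<close>

lemma col_perm_swap_entries:
  assumes "\<tau> \<in> fillings \<alpha>" "i \<in> {1..<sum_list \<alpha>}"
  shows "col_perm \<alpha> (swap_entries i \<tau>) = adj_transp i \<circ> col_perm \<alpha> \<tau>"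
proof
  fix p
  have "adj_transp i p = p" if "p \<notin> {1..sum_list \<alpha>}"
    using that assms(2) by (auto simp: adj_transp_def Transposition.transpose_def)
  then show "col_perm \<alpha> (swap_entries i \<tau>) p = (adj_transp i \<circ> col_perm \<alpha> \<tau>) p"
    using col_perm_eq[OF assms(1), of p] col_perm_eq[OF swap_entries_fillings[OF assms], of p]
    by (auto simp: swap_entries_def)
qed

lemma finite_cell_inversions:
  assumes "\<tau> \<in> fillings \<alpha>"
  shows "finite (cell_inversions \<alpha> \<tau>)" "card (cell_inversions \<alpha> \<tau>) \<le> card (diagram \<alpha> \<times> diagram \<alpha>)"
proof -
  have sub: "cell_inversions \<alpha> \<tau> \<subseteq> diagram \<alpha> \<times> diagram \<alpha>"
    by (auto simp: cell_inversions_def)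
  have fin: "finite (diagram \<alpha> \<times> diagram \<alpha>)"
    by (metis List.finite_set finite_cartesian_product set_reading)
  show "finite (cell_inversions \<alpha> \<tau>)" using sub fin by (rule finite_subset)
  show "card (cell_inversions \<alpha> \<tau>) \<le> card (diagram \<alpha> \<times> diagram \<alpha>)"
    using fin sub by (rule card_mono)
qed

section \<open>The order given by the 0-Hecke action\<close>

lemma hecke_pi_frag_of:
  "hecke_pi \<alpha> i (frag_of \<tau>) = (if i \<notin> Des \<alpha> \<tau> then frag_of \<tau>
    else if attacking \<alpha> \<tau> i then 0 else frag_of (swap_entries i \<tau>))"
  by (simp add: hecke_pi_def)

lemma hecke_pi_word_simps [simp]:
  "hecke_pi_word \<alpha> [] x = x" "hecke_pi_word \<alpha> (i # w) x = hecke_pi \<alpha> i (hecke_pi_word \<alpha> w x)"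
  by (simp_all add: hecke_pi_word_def)

text \<open>Each operator fixes a basis element, sends it to zero or adds one inversion. This is
  already visible on fillings, so the tableau conditions need not be carried along.\<close>

lemma hecke_pi_word_increasing:
  assumes "\<tau> \<in> fillings \<alpha>" "set w \<subseteq> {1..<sum_list \<alpha>}"
  shows "hecke_pi_word \<alpha> w (frag_of \<tau>) = 0 \<or>
    (\<exists>\<rho> \<in> fillings \<alpha>. hecke_pi_word \<alpha> w (frag_of \<tau>) = frag_of \<rho> \<and>
      cell_inversions \<alpha> \<tau> \<subseteq> cell_inversions \<alpha> \<rho>)"
  using assms(2)
proof (induction w)
  case Nil
  then show ?case using assms(1) by auto
next
  case (Cons i w)
  then consider "hecke_pi_word \<alpha> w (frag_of \<tau>) = 0" | \<rho> where "\<rho> \<in> fillings \<alpha>"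
    "hecke_pi_word \<alpha> w (frag_of \<tau>) = frag_of \<rho>" "cell_inversions \<alpha> \<tau> \<subseteq> cell_inversions \<alpha> \<rho>"
    by auto
  then show ?case
  proof cases
    case 1
    then show ?thesis by (simp add: hecke_pi_def)
  next
    case 2
    have i: "i \<in> {1..<sum_list \<alpha>}" using Cons.prems by simp
    show ?thesis
    proof (cases "i \<in> Des \<alpha> \<rho> \<and> \<not> attacking \<alpha> \<rho> i")
      case True
      have "cell_inversions \<alpha> \<rho> \<subseteq> cell_inversions \<alpha> (swap_entries i \<rho>)"
        using True cell_inversions_swap_entries(1)[OF 2(1) i Des_non_attacking_read_before] by blast
      moreover have "swap_entries i \<rho> \<in> fillings \<alpha>"
        using 2(1) i by (rule swap_entries_fillings)
      ultimately show ?thesis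
        using True 2(2,3) by (auto simp: hecke_pi_frag_of)
    next
      case False
      then show ?thesis using 2 by (auto simp: hecke_pi_frag_of)
    qed
  qed
qed

text \<open>
  The length condition makes every suffix of the word length-additive, hence a path inside the
  class.  It holds for every reduced word, so the braid relations for the operators are not needed.
\<close>

lemma hecke_pi_word_reaches:
  assumes \<tau>: "\<tau> \<in> SRCT \<alpha>"
    and "\<rho> \<in> SRCT \<alpha>" "same_columns \<alpha> \<tau> \<rho>" "set w \<subseteq> {1..<sum_list \<alpha>}"
    and "word_perm w \<circ> col_perm \<alpha> \<tau> = col_perm \<alpha> \<rho>"
    and "card (inversions (sum_list \<alpha>) (col_perm \<alpha> \<tau>)) + length w
      = card (inversions (sum_list \<alpha>) (col_perm \<alpha> \<rho>))"
  shows "hecke_pi_word \<alpha> w (frag_of \<tau>) = frag_of \<rho>"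
  using assms(2-)
\<comment> \<open>The head of the word acts last, so the path is shortened at its upper end:
  \<open>\<rho>\<close> varies while \<open>\<tau>\<close> stays fixed.\<close>
proof (induction w arbitrary: \<rho>)
  case Nil
  then show ?case
    using col_perm_eq_iff[OF SRCT_imp_fillings SRCT_imp_fillings] \<tau> by (simp add: frag_of_eq)
next
  case (Cons i w)
  let ?inv = "inversions (sum_list \<alpha>)"
  define \<sigma> where "\<sigma> = word_perm w \<circ> col_perm \<alpha> \<tau>"
  have f: "\<tau> \<in> fillings \<alpha>" "\<rho> \<in> fillings \<alpha>"
    using \<tau> Cons.prems(1) by (auto intro: SRCT_imp_fillings)
  have w: "set w \<subseteq> {1..<sum_list \<alpha>}" and i: "i \<in> {1..<sum_list \<alpha>}"
    using Cons.prems(3) by auto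
  have perm: "\<sigma> permutes {1..sum_list \<alpha>}"
    unfolding \<sigma>_def using w by (intro permutes_compose word_perm_permutes col_perm_permutes f)
  have \<rho>_eq: "col_perm \<alpha> \<rho> = adj_transp i \<circ> \<sigma>"
    using Cons.prems(4) by (simp add: \<sigma>_def o_assoc del: o_apply)
  have le: "card (?inv \<sigma>) \<le> card (?inv (col_perm \<alpha> \<tau>)) + length w"
    unfolding \<sigma>_def using w by (intro card_inversions_word_perm_le col_perm_permutes f)
  with Cons.prems(5) have "card (?inv \<sigma>) < card (?inv (adj_transp i \<circ> \<sigma>))"
    by (simp add: \<rho>_eq del: o_apply)
  note step = inversions_adj_transp_mono[OF perm i this]
  have card: "card (?inv (col_perm \<alpha> \<tau>)) + length w = card (?inv \<sigma>)"
    using step(2) Cons.prems(5) by (simp add: \<rho>_eq del: o_apply)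
  \<comment> \<open>The result of the shorter word is not yet known. A candidate is read off from
    the intermediate permutation and recognised as a member of the class by convexity, which makes
    the induction hypothesis applicable.\<close>
  obtain \<nu> where \<nu>: "\<nu> \<in> fillings \<alpha>" "col_perm \<alpha> \<nu> = \<sigma>"
    using ex_filling_of_permutation[OF f(1) perm] by blast
  have "?inv (col_perm \<alpha> \<tau>) \<subseteq> ?inv (col_perm \<alpha> \<nu>)"
    using inversions_word_perm_mono[OF col_perm_permutes[OF f(1)] w] card by (simp add: \<nu>(2) \<sigma>_def del: o_apply)
  then have sub1: "cell_inversions \<alpha> \<tau> \<subseteq> cell_inversions \<alpha> \<nu>"
    using inversions_col_perm_subset_iff[OF f(1) \<nu>(1)] by simp
  have sub2: "cell_inversions \<alpha> \<nu> \<subseteq> cell_inversions \<alpha> \<rho>"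
    using inversions_col_perm_subset_iff[OF \<nu>(1) f(2)] step(1) by (simp add: \<nu>(2) \<rho>_eq del: o_apply)
  note SRCT_\<nu> = convex_SRCT[OF \<tau> Cons.prems(1,2) \<nu>(1) sub1 sub2]
  have IH: "hecke_pi_word \<alpha> w (frag_of \<tau>) = frag_of \<nu>"
    using Cons.IH[OF SRCT_\<nu> w] card by (simp add: \<nu>(2) \<sigma>_def del: o_apply)
  have swap: "swap_entries i \<nu> = \<rho>"
    using col_perm_eq_iff[OF swap_entries_fillings[OF \<nu>(1) i] f(2)] col_perm_swap_entries[OF \<nu>(1) i]
    by (simp add: \<nu>(2) \<rho>_eq del: o_apply)
  have same: "same_columns \<alpha> \<nu> \<rho>"
    using same_columns_trans[OF same_columns_sym[OF SRCT_\<nu>(2)] Cons.prems(2)] .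
  have "read_before (cell_of \<alpha> \<nu> i) (cell_of \<alpha> \<nu> (i + 1))"
  proof (rule ccontr)
    \<comment> \<open>The exchange would then destroy the inversion \<open>(d, c)\<close> of
      \<open>\<nu>\<close>, although \<open>\<rho>\<close> contains all inversions of
      \<open>\<nu>\<close>.\<close>
    assume not_before: "\<not> ?thesis"
    obtain c d where cd: "cell_of \<alpha> \<nu> i = c" "cell_of \<alpha> \<nu> (i + 1) = d" by blast
    have val: "\<nu> c = i" "\<nu> d = Suc i" "c \<in> diagram \<alpha>" "d \<in> diagram \<alpha>"
      using filling_cell_of[OF \<nu>(1), of i] filling_cell_of[OF \<nu>(1), of "i + 1"]
        cell_of_in_diagram[OF \<nu>(1), of i] cell_of_in_diagram[OF \<nu>(1), of "i + 1"] i cd by auto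
    then have "c \<noteq> d" by auto
    then have "read_before d c"
      using not_before unfolding cd by (cases c; cases d) (auto simp: read_before_def)
    then have "(d, c) \<in> cell_inversions \<alpha> \<nu>"
      using val by (simp add: cell_inversions_def)
    moreover have "(d, c) \<notin> cell_inversions \<alpha> \<rho>"
      using val by (simp add: cell_inversions_def swap[symmetric] swap_entries_def)
    ultimately show False using sub2 by blast
  qed
  then have "i \<in> Des \<alpha> \<nu>" "\<not> attacking \<alpha> \<nu> i"
    using non_attacking_descentI[OF SRCT_\<nu>(1) _ _ i] Cons.prems(1) same swap by auto
  then show ?case
    by (simp add: IH hecke_pi_frag_of swap)
qed

lemma srct_le_iff_cell_inversions:
  assumes "\<tau> \<in> SRCT \<alpha>" "\<rho> \<in> SRCT \<alpha>" "same_columns \<alpha> \<tau> \<rho>"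
  shows "srct_le \<alpha> \<tau> \<rho> \<longleftrightarrow> cell_inversions \<alpha> \<tau> \<subseteq> cell_inversions \<alpha> \<rho>"
proof
  have f: "\<tau> \<in> fillings \<alpha>" using assms(1) by (rule SRCT_imp_fillings)
  assume "srct_le \<alpha> \<tau> \<rho>"
  then obtain \<sigma> where \<sigma>: "\<sigma> permutes {1..sum_list \<alpha>}" "hecke_pi_perm \<alpha> \<sigma> (frag_of \<tau>) = frag_of \<rho>"
    by (auto simp: srct_le_def)
  define w where "w = (SOME w. reduced_word (sum_list \<alpha>) \<sigma> w)"
  have "reduced_word (sum_list \<alpha>) \<sigma> w"
    unfolding w_def using reduced_word_exists[OF \<sigma>(1)] by (rule someI_ex)
  then have "set w \<subseteq> {1..<sum_list \<alpha>}" by (simp add: reduced_word_def)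
  \<comment> \<open>The image is the basis element of \<open>\<rho>\<close>, which is not zero and
    determines \<open>\<rho>\<close>.\<close>
  then show "cell_inversions \<alpha> \<tau> \<subseteq> cell_inversions \<alpha> \<rho>"
    using hecke_pi_word_increasing[OF f] \<sigma>(2)
    by (fastforce simp: hecke_pi_perm_def w_def[symmetric] frag_of_eq)
next
  let ?n = "sum_list \<alpha>" and ?p = "col_perm \<alpha> \<tau>" and ?q = "col_perm \<alpha> \<rho>"
  have f: "\<tau> \<in> fillings \<alpha>" "\<rho> \<in> fillings \<alpha>"
    using assms(1,2) by (auto intro: SRCT_imp_fillings)
  have perm: "?p permutes {1..?n}" "?q permutes {1..?n}"
    by (intro col_perm_permutes f)+
  assume "cell_inversions \<alpha> \<tau> \<subseteq> cell_inversions \<alpha> \<rho>"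
  then have "inversions ?n ?p \<subseteq> inversions ?n ?q"
    using inversions_col_perm_subset_iff[OF f] by simp
  then obtain js where js: "set js \<subseteq> {1..<?n}" "?q = word_perm (rev js) \<circ> ?p"
    "\<forall>r \<le> length js. card (inversions ?n (word_perm (rev (take r js)) \<circ> ?p)) = card (inversions ?n ?p) + r"
    using inversions_subset_chain[OF perm] by blast
  define \<sigma> where "\<sigma> = word_perm (rev js)"
  have \<sigma>: "\<sigma> permutes {1..?n}"
    unfolding \<sigma>_def using js(1) by (intro word_perm_permutes) simp
  define w where "w = (SOME w. reduced_word ?n \<sigma> w)"
  have "reduced_word ?n \<sigma> w"
    unfolding w_def using reduced_word_exists[OF \<sigma>] by (rule someI_ex)
  then have w: "set w \<subseteq> {1..<?n}" "word_perm w = \<sigma>" "length w = card (inversions ?n \<sigma>)"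
    by (simp_all add: reduced_word_def cox_length_eq_card_inversions[OF \<sigma>])
  have eq: "word_perm w \<circ> ?p = ?q"
    using js(2) by (simp add: w(2) \<sigma>_def)
  \<comment> \<open>The chosen word \<open>w\<close> need not be \<open>rev js\<close>; only the
    products agree. Its length is squeezed: being reduced, it is no longer than \<open>js\<close>,
    and it must produce the \<open>length js\<close> new inversions with at most one per
    letter.\<close>
  have "length w \<le> length js"
    using card_inversions_word_perm_le[OF permutes_id, of "rev js" ?n] js(1) by (simp add: w(3) \<sigma>_def)
  moreover have "card (inversions ?n ?q) = card (inversions ?n ?p) + length js"
    using js(2) js(3)[rule_format, of "length js"] by simp
  moreover have "card (inversions ?n ?q) \<le> card (inversions ?n ?p) + length w"
    using card_inversions_word_perm_le[OF perm(1) w(1)] unfolding eq .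
  ultimately have "hecke_pi_word \<alpha> w (frag_of \<tau>) = frag_of \<rho>"
    using assms w(1) eq by (intro hecke_pi_word_reaches) auto
  then show "srct_le \<alpha> \<tau> \<rho>"
    unfolding srct_le_def hecke_pi_perm_def w_def using \<sigma> by blast
qed

section \<open>The poset structure of a class\<close>

locale srct_class =
  fixes \<alpha> :: "nat list" and E :: "filling set"
  assumes is_class: "E \<in> SRCT \<alpha> // srct_equiv \<alpha>"
begin

abbreviation below :: "filling \<Rightarrow> filling \<Rightarrow> bool" (infix \<open>\<unlhd>\<close> 50) where
  "\<tau> \<unlhd> \<rho> \<equiv> cell_inversions \<alpha> \<tau> \<subseteq> cell_inversions \<alpha> \<rho>"

lemma subset_SRCT: "E \<subseteq> SRCT \<alpha>"
  and nonempty: "E \<noteq> {}"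
  and member_iff: "\<tau> \<in> E \<Longrightarrow> \<rho> \<in> E \<longleftrightarrow> \<rho> \<in> SRCT \<alpha> \<and> same_columns \<alpha> \<tau> \<rho>"
proof -
  obtain \<tau>\<^sub>0 where \<tau>\<^sub>0: "\<tau>\<^sub>0 \<in> SRCT \<alpha>" "E = srct_equiv \<alpha> `` {\<tau>\<^sub>0}"
    using is_class by (auto elim: quotientE)
  have E: "E = {\<rho> \<in> SRCT \<alpha>. same_columns \<alpha> \<tau>\<^sub>0 \<rho>}"
    using \<tau>\<^sub>0 st_col_word_eq_iff SRCT_imp_fillings by (auto simp: srct_equiv_def)
  then show "E \<subseteq> SRCT \<alpha>" "E \<noteq> {}" using \<tau>\<^sub>0(1) by auto
  show "\<tau> \<in> E \<Longrightarrow> \<rho> \<in> E \<longleftrightarrow> \<rho> \<in> SRCT \<alpha> \<and> same_columns \<alpha> \<tau> \<rho>"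
    unfolding E using same_columns_trans same_columns_sym by blast
qed

lemma SRCT [simp]: "\<tau> \<in> E \<Longrightarrow> \<tau> \<in> SRCT \<alpha>"
  using subset_SRCT by (rule subsetD)

lemma filling [simp]: "\<tau> \<in> E \<Longrightarrow> \<tau> \<in> fillings \<alpha>"
  by (rule SRCT_imp_fillings[OF SRCT])

lemma same: "\<tau> \<in> E \<Longrightarrow> \<rho> \<in> E \<Longrightarrow> same_columns \<alpha> \<tau> \<rho>"
  by (simp add: member_iff[of \<tau> \<rho>])

lemma convex:
  assumes "\<tau> \<in> E" "\<rho> \<in> E" "\<nu> \<in> fillings \<alpha>" "\<tau> \<unlhd> \<nu>" "\<nu> \<unlhd> \<rho>"
  shows "\<nu> \<in> E"
  using convex_SRCT[OF SRCT[OF assms(1)] SRCT[OF assms(2)] same[OF assms(1,2)] assms(3-5)]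
  by (simp add: member_iff[OF assms(1)])

lemma antisym: "\<tau> \<in> E \<Longrightarrow> \<rho> \<in> E \<Longrightarrow> \<tau> \<unlhd> \<rho> \<Longrightarrow> \<rho> \<unlhd> \<tau> \<Longrightarrow> \<tau> = \<rho>"
  by (intro cell_inversions_eq_imp_eq[of _ \<alpha>]) auto

lemma srct_le_iff: "\<tau> \<in> E \<Longrightarrow> \<rho> \<in> E \<Longrightarrow> srct_le \<alpha> \<tau> \<rho> \<longleftrightarrow> \<tau> \<unlhd> \<rho>"
  by (intro srct_le_iff_cell_inversions same) auto

text \<open>A member with fewest inversions is a source: any violation could be exchanged by
  \<open>swap_entries_descend\<close>, giving a member with fewer.\<close>

lemma ex_source: "\<exists>\<tau> \<in> E. source_tableau \<alpha> \<tau>"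
proof -
  obtain \<tau> where \<tau>: "\<tau> \<in> E" "\<And>\<rho>. \<rho> \<in> E \<Longrightarrow> card (cell_inversions \<alpha> \<tau>) \<le> card (cell_inversions \<alpha> \<rho>)"
    using ex_has_least_nat[of "\<lambda>\<tau>. \<tau> \<in> E" _ "\<lambda>\<tau>. card (cell_inversions \<alpha> \<tau>)"] nonempty by blast
  have "source_tableau \<alpha> \<tau>"
    unfolding source_tableau_def
  proof (intro ballI impI, rule ccontr)
    fix i assume i: "i \<in> {1..sum_list \<alpha>}" "i \<notin> Des \<alpha> \<tau> \<and> i \<noteq> sum_list \<alpha>"
      and "\<not> (row_of \<alpha> \<tau> (i + 1) = row_of \<alpha> \<tau> i \<and> col_of \<alpha> \<tau> (i + 1) + 1 = col_of \<alpha> \<tau> i)"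
    moreover have "i \<in> {1..<sum_list \<alpha>}" using i by auto
    ultimately have down: "swap_entries i \<tau> \<in> E"
      "cell_inversions \<alpha> (swap_entries i \<tau>) \<subset> cell_inversions \<alpha> \<tau>"
      using swap_entries_descend[of \<tau> \<alpha> i] \<tau>(1) member_iff[OF \<tau>(1)] by auto
    then show False
      using \<tau>(2)[OF down(1)] psubset_card_mono[OF finite_cell_inversions(1)[OF filling[OF \<tau>(1)]] down(2)] by simp
  qed
  with \<tau>(1) show ?thesis by blast
qed

lemma ex_sink: "\<exists>\<tau> \<in> E. sink_tableau \<alpha> \<tau>"
proof -
  obtain \<tau>\<^sub>0 where \<tau>\<^sub>0: "\<tau>\<^sub>0 \<in> E" using nonempty by blast
  \<comment> \<open>Maximising needs a uniform bound; inversions are pairs of cells.\<close>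
  have bound: "\<forall>\<rho>. \<rho> \<in> E \<longrightarrow> card (cell_inversions \<alpha> \<rho>) < Suc (card (diagram \<alpha> \<times> diagram \<alpha>))"
    using finite_cell_inversions(2)[OF filling] by (simp add: less_Suc_eq_le)
  obtain \<tau> where \<tau>: "\<tau> \<in> E" "\<And>\<rho>. \<rho> \<in> E \<Longrightarrow> card (cell_inversions \<alpha> \<rho>) \<le> card (cell_inversions \<alpha> \<tau>)"
    using ex_has_greatest_nat[of "\<lambda>\<tau>. \<tau> \<in> E", OF \<tau>\<^sub>0 bound] by blast
  have "sink_tableau \<alpha> \<tau>"
    unfolding sink_tableau_def
  proof (intro ballI, rule ccontr)
    fix i assume "i \<in> Des \<alpha> \<tau>" "\<not> attacking \<alpha> \<tau> i"
    then have up: "swap_entries i \<tau> \<in> E"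
      "cell_inversions \<alpha> \<tau> \<subset> cell_inversions \<alpha> (swap_entries i \<tau>)"
      using swap_entries_ascend[of \<tau> \<alpha> i] \<tau>(1) member_iff[OF \<tau>(1)] by auto
    then show False
      using \<tau>(2)[OF up(1)] psubset_card_mono[OF finite_cell_inversions(1)[OF filling[OF up(1)]] up(2)] by simp
  qed
  with \<tau>(1) show ?thesis by blast
qed

text \<open>Leastness and antisymmetry make the source tableau unique, which justifies the definite
  description in \<open>source_of\<close>.\<close>

lemma source_of_in: "source_of \<alpha> E \<in> E"
  and source_of_least: "\<tau> \<in> E \<Longrightarrow> source_of \<alpha> E \<unlhd> \<tau>"
proof -
  have least: "\<tau> \<unlhd> \<rho>" if "\<tau> \<in> E" "source_tableau \<alpha> \<tau>" "\<rho> \<in> E" for \<tau> \<rho>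
    using that by (intro source_tableau_least same) auto
  have "\<exists>!\<tau>. \<tau> \<in> E \<and> source_tableau \<alpha> \<tau>"
    using ex_source least antisym by blast
  from theI'[OF this] have source: "source_of \<alpha> E \<in> E" "source_tableau \<alpha> (source_of \<alpha> E)"
    by (auto simp: source_of_def)
  then show "source_of \<alpha> E \<in> E" "\<tau> \<in> E \<Longrightarrow> source_of \<alpha> E \<unlhd> \<tau>"
    using least by blast+
qed

lemma sink_of_in: "sink_of \<alpha> E \<in> E"
  and sink_of_greatest: "\<tau> \<in> E \<Longrightarrow> \<tau> \<unlhd> sink_of \<alpha> E"
proof -
  have greatest: "\<rho> \<unlhd> \<tau>" if "\<tau> \<in> E" "sink_tableau \<alpha> \<tau>" "\<rho> \<in> E" for \<tau> \<rho>
    using that by (intro sink_tableau_greatest same) auto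
  have "\<exists>!\<tau>. \<tau> \<in> E \<and> sink_tableau \<alpha> \<tau>"
    using ex_sink greatest antisym by blast
  from theI'[OF this] have sink: "sink_of \<alpha> E \<in> E" "sink_tableau \<alpha> (sink_of \<alpha> E)"
    by (auto simp: sink_of_def)
  then show "sink_of \<alpha> E \<in> E" "\<tau> \<in> E \<Longrightarrow> \<tau> \<unlhd> sink_of \<alpha> E"
    using greatest by blast+
qed

section \<open>Joins, meets and covers inside a class\<close>

text \<open>The join is taken among all permutations. The sink is a common upper bound, so the join
  lies between \<open>\<tau>\<close> and the sink and belongs to the class by convexity.\<close>

lemma join:
  assumes "\<tau> \<in> E" "\<rho> \<in> E"
  obtains \<mu> where "\<mu> \<in> E" "\<tau> \<unlhd> \<mu>" "\<rho> \<unlhd> \<mu>" "\<And>\<nu>. \<nu> \<in> E \<Longrightarrow> \<tau> \<unlhd> \<nu> \<Longrightarrow> \<rho> \<unlhd> \<nu> \<Longrightarrow> \<mu> \<unlhd> \<nu>"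
proof -
  note sub = inversions_col_perm_subset_iff
  obtain \<sigma> where \<sigma>: "\<sigma> permutes {1..sum_list \<alpha>}"
    "inversions (sum_list \<alpha>) (col_perm \<alpha> \<tau>) \<subseteq> inversions (sum_list \<alpha>) \<sigma>"
    "inversions (sum_list \<alpha>) (col_perm \<alpha> \<rho>) \<subseteq> inversions (sum_list \<alpha>) \<sigma>"
    "\<And>\<nu>. \<nu> permutes {1..sum_list \<alpha>} \<Longrightarrow>
      inversions (sum_list \<alpha>) (col_perm \<alpha> \<tau>) \<subseteq> inversions (sum_list \<alpha>) \<nu> \<Longrightarrow>
      inversions (sum_list \<alpha>) (col_perm \<alpha> \<rho>) \<subseteq> inversions (sum_list \<alpha>) \<nu> \<Longrightarrow>
      inversions (sum_list \<alpha>) \<sigma> \<subseteq> inversions (sum_list \<alpha>) \<nu>"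
    using inversions_join[OF col_perm_permutes col_perm_permutes, OF filling filling, OF assms] by metis
  obtain \<mu> where \<mu>: "\<mu> \<in> fillings \<alpha>" "col_perm \<alpha> \<mu> = \<sigma>"
    using ex_filling_of_permutation[OF filling[OF assms(1)] \<sigma>(1)] by blast
  have ub: "\<tau> \<unlhd> \<mu>" "\<rho> \<unlhd> \<mu>"
    using \<sigma>(2,3) sub[OF _ \<mu>(1)] assms by (simp_all add: \<mu>(2))
  have least: "\<mu> \<unlhd> \<nu>" if "\<nu> \<in> E" "\<tau> \<unlhd> \<nu>" "\<rho> \<unlhd> \<nu>" for \<nu>
    using \<sigma>(4)[of "col_perm \<alpha> \<nu>"] that assms sub[OF \<mu>(1), of \<nu>]
    by (simp add: \<mu>(2) sub col_perm_permutes del: One_nat_def)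
  have "\<mu> \<in> E"
    using convex[OF assms(1) sink_of_in \<mu>(1) ub(1)] least sink_of_in sink_of_greatest assms by simp
  then show thesis using that ub least by blast
qed

lemma meet:
  assumes "\<tau> \<in> E" "\<rho> \<in> E"
  obtains \<mu> where "\<mu> \<in> E" "\<mu> \<unlhd> \<tau>" "\<mu> \<unlhd> \<rho>" "\<And>\<nu>. \<nu> \<in> E \<Longrightarrow> \<nu> \<unlhd> \<tau> \<Longrightarrow> \<nu> \<unlhd> \<rho> \<Longrightarrow> \<nu> \<unlhd> \<mu>"
proof -
  note sub = inversions_col_perm_subset_iff
  obtain \<sigma> where \<sigma>: "\<sigma> permutes {1..sum_list \<alpha>}"
    "inversions (sum_list \<alpha>) \<sigma> \<subseteq> inversions (sum_list \<alpha>) (col_perm \<alpha> \<tau>)"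
    "inversions (sum_list \<alpha>) \<sigma> \<subseteq> inversions (sum_list \<alpha>) (col_perm \<alpha> \<rho>)"
    "\<And>\<nu>. \<nu> permutes {1..sum_list \<alpha>} \<Longrightarrow>
      inversions (sum_list \<alpha>) \<nu> \<subseteq> inversions (sum_list \<alpha>) (col_perm \<alpha> \<tau>) \<Longrightarrow>
      inversions (sum_list \<alpha>) \<nu> \<subseteq> inversions (sum_list \<alpha>) (col_perm \<alpha> \<rho>) \<Longrightarrow>
      inversions (sum_list \<alpha>) \<nu> \<subseteq> inversions (sum_list \<alpha>) \<sigma>"
    using inversions_meet[OF col_perm_permutes col_perm_permutes, OF filling filling, OF assms] by metis
  obtain \<mu> where \<mu>: "\<mu> \<in> fillings \<alpha>" "col_perm \<alpha> \<mu> = \<sigma>"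
    using ex_filling_of_permutation[OF filling[OF assms(1)] \<sigma>(1)] by blast
  have lb: "\<mu> \<unlhd> \<tau>" "\<mu> \<unlhd> \<rho>"
    using \<sigma>(2,3) sub[OF \<mu>(1)] assms by (simp_all add: \<mu>(2))
  have greatest: "\<nu> \<unlhd> \<mu>" if "\<nu> \<in> E" "\<nu> \<unlhd> \<tau>" "\<nu> \<unlhd> \<rho>" for \<nu>
    using \<sigma>(4)[of "col_perm \<alpha> \<nu>"] that assms sub[OF _ \<mu>(1), of \<nu>]
    by (simp add: \<mu>(2) sub col_perm_permutes del: One_nat_def)
  have "\<mu> \<in> E"
    using convex[OF source_of_in assms(1) \<mu>(1) _ lb(1)] greatest source_of_in source_of_least assms by simp
  then show thesis using that lb greatest by blast
qed

text \<open>An adjacent exchange towards \<open>\<rho>\<close> stays between \<open>\<tau>\<close>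
  and \<open>\<rho>\<close>, hence in the class. Covers inside the class are therefore single
  exchanges, which yields the grading.\<close>

lemma cover_step:
  assumes "\<tau> \<in> E" "\<rho> \<in> E" "\<tau> \<unlhd> \<rho>" "\<tau> \<noteq> \<rho>"
  obtains \<nu> where "\<nu> \<in> E" "\<tau> \<unlhd> \<nu>" "\<nu> \<unlhd> \<rho>"
    "card (inversions (sum_list \<alpha>) (col_perm \<alpha> \<nu>)) = Suc (card (inversions (sum_list \<alpha>) (col_perm \<alpha> \<tau>)))"
proof -
  let ?inv = "inversions (sum_list \<alpha>)"
  have f: "\<tau> \<in> fillings \<alpha>" "\<rho> \<in> fillings \<alpha>" using assms by auto
  have "?inv (col_perm \<alpha> \<tau>) \<subseteq> ?inv (col_perm \<alpha> \<rho>)" "col_perm \<alpha> \<tau> \<noteq> col_perm \<alpha> \<rho>"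
    using assms(3,4) f by (simp_all add: inversions_col_perm_subset_iff col_perm_eq_iff)
  from inversions_subset_step[OF col_perm_permutes[OF f(1)] col_perm_permutes[OF f(2)] this]
  obtain i where i: "i \<in> {1..<sum_list \<alpha>}"
    "card (?inv (adj_transp i \<circ> col_perm \<alpha> \<tau>)) = Suc (card (?inv (col_perm \<alpha> \<tau>)))"
    "?inv (col_perm \<alpha> \<tau>) \<subseteq> ?inv (adj_transp i \<circ> col_perm \<alpha> \<tau>)"
    "?inv (adj_transp i \<circ> col_perm \<alpha> \<tau>) \<subseteq> ?inv (col_perm \<alpha> \<rho>)"
    by metis
  note swap = col_perm_swap_entries[OF f(1) i(1), symmetric] swap_entries_fillings[OF f(1) i(1)]
  have "\<tau> \<unlhd> swap_entries i \<tau>" "swap_entries i \<tau> \<unlhd> \<rho>"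
    using i(3,4) inversions_col_perm_subset_iff f swap(2) unfolding swap(1) by blast+
  moreover have "swap_entries i \<tau> \<in> E"
    using convex[OF assms(1,2) swap(2)] calculation by blast
  ultimately show thesis
    using that i(2) unfolding swap(1) by blast
qed

section \<open>The class as a lattice, as a graded poset and as an interval\<close>

abbreviation poset :: "filling gorder" where
  "poset \<equiv> srct_poset \<alpha>\<lparr>carrier := E\<rparr>"

lemma poset_simps [simp]:
  "carrier poset = E" "gorder.le poset = srct_le \<alpha>" "eq poset = (=)"
  by (simp_all add: srct_poset_def)

lemma partial_order_poset: "partial_order poset"
proof
  fix \<tau> \<rho> \<nu>
  show "\<tau> \<sqsubseteq>\<^bsub>poset\<^esub> \<tau>" if "\<tau> \<in> carrier poset"
    using that by (simp add: srct_le_iff)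
  show "\<tau> .=\<^bsub>poset\<^esub> \<rho>"
    if "\<tau> \<sqsubseteq>\<^bsub>poset\<^esub> \<rho>" "\<rho> \<sqsubseteq>\<^bsub>poset\<^esub> \<tau>" "\<tau> \<in> carrier poset" "\<rho> \<in> carrier poset"
    using that antisym srct_le_iff unfolding poset_simps by blast
  show "\<tau> \<sqsubseteq>\<^bsub>poset\<^esub> \<nu>"
    if "\<tau> \<sqsubseteq>\<^bsub>poset\<^esub> \<rho>" "\<rho> \<sqsubseteq>\<^bsub>poset\<^esub> \<nu>" "\<tau> \<in> carrier poset" "\<rho> \<in> carrier poset" "\<nu> \<in> carrier poset"
    using that srct_le_iff unfolding poset_simps by blast
qed auto

lemma lattice_poset: "lattice poset"
proof -
  interpret partial_order poset by (rule partial_order_poset)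
  show ?thesis
  proof
    fix \<tau> \<rho> assume "\<tau> \<in> carrier poset" "\<rho> \<in> carrier poset"
    then have E: "\<tau> \<in> E" "\<rho> \<in> E" by simp_all
    from join[OF E] obtain \<mu> where "\<mu> \<in> E" "\<tau> \<unlhd> \<mu>" "\<rho> \<unlhd> \<mu>"
      "\<And>\<nu>. \<nu> \<in> E \<Longrightarrow> \<tau> \<unlhd> \<nu> \<Longrightarrow> \<rho> \<unlhd> \<nu> \<Longrightarrow> \<mu> \<unlhd> \<nu>" by metis
    moreover have "Upper poset {\<tau>, \<rho>} = {\<nu> \<in> E. \<tau> \<unlhd> \<nu> \<and> \<rho> \<unlhd> \<nu>}"
      unfolding Upper_def poset_simps using E srct_le_iff by blast
    ultimately have "least poset \<mu> (Upper poset {\<tau>, \<rho>})"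
      by (simp add: least_def srct_le_iff)
    then show "\<exists>s. least poset s (Upper poset {\<tau>, \<rho>})" by blast
    from meet[OF E] obtain \<mu> where "\<mu> \<in> E" "\<mu> \<unlhd> \<tau>" "\<mu> \<unlhd> \<rho>"
      "\<And>\<nu>. \<nu> \<in> E \<Longrightarrow> \<nu> \<unlhd> \<tau> \<Longrightarrow> \<nu> \<unlhd> \<rho> \<Longrightarrow> \<nu> \<unlhd> \<mu>" by metis
    moreover have "Lower poset {\<tau>, \<rho>} = {\<nu> \<in> E. \<nu> \<unlhd> \<tau> \<and> \<nu> \<unlhd> \<rho>}"
      unfolding Lower_def poset_simps using E srct_le_iff by blast
    ultimately have "greatest poset \<mu> (Lower poset {\<tau>, \<rho>})"
      by (simp add: greatest_def srct_le_iff)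
    then show "\<exists>s. greatest poset s (Lower poset {\<tau>, \<rho>})" by blast
  qed
qed

lemma graded_poset_poset: "graded_poset poset"
proof -
  \<comment> \<open>The rank is the Coxeter length of the column word.\<close>
  define rk where "rk \<tau> = card (inversions (sum_list \<alpha>) (col_perm \<alpha> \<tau>))" for \<tau>
  have less_iff: "\<tau> \<sqsubset>\<^bsub>poset\<^esub> \<rho> \<longleftrightarrow> \<tau> \<unlhd> \<rho> \<and> \<tau> \<noteq> \<rho>" if "\<tau> \<in> E" "\<rho> \<in> E" for \<tau> \<rho>
    using that by (simp add: lless_def srct_le_iff)
  have rk_mono: "rk \<tau> < rk \<rho>" if lt: "\<tau> \<in> E" "\<rho> \<in> E" "\<tau> \<unlhd> \<rho>" "\<tau> \<noteq> \<rho>" for \<tau> \<rho>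
  proof -
    obtain \<nu> where "\<nu> \<in> E" "\<nu> \<unlhd> \<rho>" "rk \<nu> = Suc (rk \<tau>)"
      using cover_step[OF lt] unfolding rk_def by metis
    moreover have "rk \<nu> \<le> rk \<rho>"
      unfolding rk_def using calculation(1,2) lt(2)
      by (intro card_mono) (simp_all add: inversions_col_perm_subset_iff)
    ultimately show ?thesis by simp
  qed
  have "rk \<rho> = rk \<tau> + 1" if E: "\<tau> \<in> E" "\<rho> \<in> E" and cov: "covered_by poset \<tau> \<rho>" for \<tau> \<rho>
  proof -
    have lt: "\<tau> \<unlhd> \<rho>" "\<tau> \<noteq> \<rho>"
      using cov less_iff[OF E] by (auto simp: covered_by_def)
    obtain \<nu> where \<nu>: "\<nu> \<in> E" "\<tau> \<unlhd> \<nu>" "\<nu> \<unlhd> \<rho>" "rk \<nu> = Suc (rk \<tau>)"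
      using cover_step[OF E lt] unfolding rk_def by metis
    then have "\<tau> \<noteq> \<nu>" by auto
    then have "\<nu> = \<rho>"
      using cov \<nu> less_iff E by (auto simp: covered_by_def)
    with \<nu>(4) show ?thesis by simp
  qed
  then show ?thesis
    unfolding graded_poset_def using partial_order_poset less_iff rk_mono
    by (intro conjI exI[of _ rk]) auto
qed

lemma col_perm_image:
  "col_perm \<alpha> ` E = {\<sigma>. \<sigma> permutes {1..sum_list \<alpha>} \<and>
    weak_bruhat_le (sum_list \<alpha>) (col_perm \<alpha> (source_of \<alpha> E)) \<sigma> \<and>
    weak_bruhat_le (sum_list \<alpha>) \<sigma> (col_perm \<alpha> (sink_of \<alpha> E))}"
proof (intro equalityI subsetI)
  fix \<sigma> assume "\<sigma> \<in> col_perm \<alpha> ` E"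
  then obtain \<tau> where "\<tau> \<in> E" "\<sigma> = col_perm \<alpha> \<tau>" by blast
  then show "\<sigma> \<in> {\<sigma>. \<sigma> permutes {1..sum_list \<alpha>} \<and>
      weak_bruhat_le (sum_list \<alpha>) (col_perm \<alpha> (source_of \<alpha> E)) \<sigma> \<and>
      weak_bruhat_le (sum_list \<alpha>) \<sigma> (col_perm \<alpha> (sink_of \<alpha> E))}"
    using source_of_in source_of_least sink_of_in sink_of_greatest
    by (simp add: weak_bruhat_le_iff_inversions col_perm_permutes inversions_col_perm_subset_iff del: One_nat_def)
next
  fix \<sigma> assume "\<sigma> \<in> {\<sigma>. \<sigma> permutes {1..sum_list \<alpha>} \<and>
      weak_bruhat_le (sum_list \<alpha>) (col_perm \<alpha> (source_of \<alpha> E)) \<sigma> \<and>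
      weak_bruhat_le (sum_list \<alpha>) \<sigma> (col_perm \<alpha> (sink_of \<alpha> E))}"
  then have \<sigma>: "\<sigma> permutes {1..sum_list \<alpha>}"
    "weak_bruhat_le (sum_list \<alpha>) (col_perm \<alpha> (source_of \<alpha> E)) \<sigma>"
    "weak_bruhat_le (sum_list \<alpha>) \<sigma> (col_perm \<alpha> (sink_of \<alpha> E))" by auto
  obtain \<tau> where \<tau>: "\<tau> \<in> fillings \<alpha>" "col_perm \<alpha> \<tau> = \<sigma>"
    using ex_filling_of_permutation[OF filling[OF source_of_in] \<sigma>(1)] by blast
  have "source_of \<alpha> E \<unlhd> \<tau>" "\<tau> \<unlhd> sink_of \<alpha> E"
    using \<sigma>(2,3) \<tau> source_of_in sink_of_in unfolding \<tau>(2)[symmetric]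
    by (simp_all add: weak_bruhat_le_iff_inversions col_perm_permutes inversions_col_perm_subset_iff del: One_nat_def)
  then show "\<sigma> \<in> col_perm \<alpha> ` E"
    using convex[OF source_of_in sink_of_in \<tau>(1)] \<tau>(2) by blast
qed

lemma poset_isomorphic_interval:
  "poset_isomorphic poset (weak_bruhat (sum_list \<alpha>)\<lparr>carrier :=
    \<lbrace>col_perm \<alpha> (source_of \<alpha> E)..col_perm \<alpha> (sink_of \<alpha> E)\<rbrace>\<^bsub>weak_bruhat (sum_list \<alpha>)\<^esub>\<rparr>)"
  (is "poset_isomorphic poset ?W")
proof -
  have carrier: "carrier ?W = col_perm \<alpha> ` E"
    unfolding col_perm_image by (simp add: at_least_at_most_def weak_bruhat_def)
  have le: "gorder.le ?W = weak_bruhat_le (sum_list \<alpha>)" and eq: "eq ?W = (=)"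
    by (simp_all add: weak_bruhat_def)
  have le_iff: "weak_bruhat_le (sum_list \<alpha>) (col_perm \<alpha> \<tau>) (col_perm \<alpha> \<rho>) \<longleftrightarrow> srct_le \<alpha> \<tau> \<rho>"
    if "\<tau> \<in> E" "\<rho> \<in> E" for \<tau> \<rho>
    using that by (simp add: weak_bruhat_le_iff_inversions col_perm_permutes inversions_col_perm_subset_iff
        srct_le_iff del: One_nat_def)
  interpret po: partial_order poset by (rule partial_order_poset)
  \<comment> \<open>An order embedding includes the order laws on both sides. Those of the interval
    are pulled back along column words to containment of cell inversions.\<close>
  have "weak_partial_order ?W"
  proof
    fix x assume "x \<in> carrier ?W"
    then obtain \<tau> where "\<tau> \<in> E" "x = col_perm \<alpha> \<tau>" unfolding carrier by blast
    then show "x \<sqsubseteq>\<^bsub>?W\<^esub> x"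
      unfolding le by (simp add: le_iff srct_le_iff)
  next
    fix x y assume xy: "x \<sqsubseteq>\<^bsub>?W\<^esub> y" "y \<sqsubseteq>\<^bsub>?W\<^esub> x" "x \<in> carrier ?W" "y \<in> carrier ?W"
    then obtain \<tau> \<rho> where E: "\<tau> \<in> E" "x = col_perm \<alpha> \<tau>" "\<rho> \<in> E" "y = col_perm \<alpha> \<rho>"
      unfolding carrier by blast
    have "\<tau> \<unlhd> \<rho>" "\<rho> \<unlhd> \<tau>"
      using xy(1,2) E(1,3) unfolding le E(2,4) by (simp_all add: le_iff srct_le_iff)
    then show "x .=\<^bsub>?W\<^esub> y"
      unfolding eq E(2,4) using antisym[OF E(1,3)] by blast
  next
    fix x y z assume xyz: "x \<sqsubseteq>\<^bsub>?W\<^esub> y" "y \<sqsubseteq>\<^bsub>?W\<^esub> z" "x \<in> carrier ?W" "y \<in> carrier ?W" "z \<in> carrier ?W"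
    then obtain \<tau> \<rho> \<nu> where "\<tau> \<in> E" "x = col_perm \<alpha> \<tau>" "\<rho> \<in> E" "y = col_perm \<alpha> \<rho>"
      "\<nu> \<in> E" "z = col_perm \<alpha> \<nu>"
      unfolding carrier by blast
    then show "x \<sqsubseteq>\<^bsub>?W\<^esub> z"
      using xyz(1,2) unfolding le by (simp add: le_iff srct_le_iff)
  qed (auto simp: eq)
  moreover have "inj_on (col_perm \<alpha>) E"
    by (intro inj_onI) (simp add: col_perm_eq_iff[of _ \<alpha>])
  ultimately show ?thesis
    unfolding poset_isomorphic_def order_emb_def bij_betw_def carrier
    using po.weak_partial_order_axioms le_iff le by (intro exI[of _ "col_perm \<alpha>"]) simp
qed

end

theorem theorem6p18:
  fixes \<alpha> :: "nat list" and n :: nat and E :: "filling set"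
  assumes "\<alpha> \<Turnstile>c n"
    and "E \<in> SRCT \<alpha> // srct_equiv \<alpha>"
  shows "lattice (srct_poset \<alpha>\<lparr>carrier := E\<rparr>)
    \<and> graded_poset (srct_poset \<alpha>\<lparr>carrier := E\<rparr>)
    \<and> poset_isomorphic (srct_poset \<alpha>\<lparr>carrier := E\<rparr>)
        (weak_bruhat n\<lparr>carrier :=
          \<lbrace>col_perm \<alpha> (source_of \<alpha> E)..col_perm \<alpha> (sink_of \<alpha> E)\<rbrace>\<^bsub>weak_bruhat n\<^esub>\<rparr>)"
proof -
  interpret srct_class \<alpha> E
    using assms(2) by unfold_locales
  have "n = sum_list \<alpha>"
    using assms(1) by (simp add: composition_of_def)
  then show ?thesis
    using lattice_poset graded_poset_poset poset_isomorphic_interval by simp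
qed

end
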